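(* Let $M$ be an $n$-dimensional submanifold of $\mathbb{R}^{n+m}$ which is a graph (i.e. $M$ is the graph of a smooth map defined on all of $\mathbb{R}^n$) and which is a self-shrinker, i.e. its mean curvature vector satisfies $H=-\frac{1}{2}\vec{x}^{N}$, where $\vec{x}$ is the position vector and $\vec{x}^N$ its component in the normal bundle $NM$. Suppose moreover that $M$ has flat normal bundle. Then $M$ is a linear subspace of $\mathbb{R}^{n+m}$.
   Context: The normal bundle $NM$ is flat if the curvature of the normal connection vanishes identically. "Graphic" is taken, as in the paper's proof, to mean an entire graph over an $n$-dimensional linear subspace, so that $M$ is properly embedded. *)

theory Defs
  imports "HOL-Analysis.Analysis"
begin

text \<open>Coordinate setting: M is the graph of u : R^n -> R^m, ambient space
R^n x R^m (= R^(n+m) with the Euclidean inner product).\<close>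

definition pd :: "'n::finite \<Rightarrow> (real^'n \<Rightarrow> 'b::real_normed_vector) \<Rightarrow> real^'n \<Rightarrow> 'b" where
  "pd i f x = vector_derivative (\<lambda>t. f (x + t *\<^sub>R axis i 1)) (at 0)"

fun pds :: "'n::finite list \<Rightarrow> (real^'n \<Rightarrow> 'b::real_normed_vector) \<Rightarrow> real^'n \<Rightarrow> 'b" where
  "pds [] f = f"
| "pds (i # is) f = pd i (pds is f)"

definition smooth_map :: "(real^'n::finite \<Rightarrow> 'b::real_normed_vector) \<Rightarrow> bool" where
  "smooth_map f \<longleftrightarrow> (\<forall>is. continuous_on UNIV (pds is f) \<and>
      (\<forall>i x. (\<lambda>t. pds is f (x + t *\<^sub>R axis i 1)) differentiable (at 0)))"

definition graph_map :: "(real^'n::finite \<Rightarrow> real^'m::finite) \<Rightarrow> real^'n \<Rightarrow> (real^'n) \<times> (real^'m)" where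
  "graph_map u x = (x, u x)"

definition tspace :: "(real^'n::finite \<Rightarrow> real^'m::finite) \<Rightarrow> real^'n \<Rightarrow> ((real^'n) \<times> (real^'m)) set" where
  "tspace u x = span (range (\<lambda>i. pd i (graph_map u) x))"

definition nproj :: "(real^'n::finite \<Rightarrow> real^'m::finite) \<Rightarrow> real^'n \<Rightarrow> (real^'n) \<times> (real^'m) \<Rightarrow> (real^'n) \<times> (real^'m)" where
  "nproj u x v = (THE w. (\<forall>i. inner w (pd i (graph_map u) x) = 0) \<and> v - w \<in> tspace u x)"

definition gmat :: "(real^'n::finite \<Rightarrow> real^'m::finite) \<Rightarrow> real^'n \<Rightarrow> real^'n^'n" where
  "gmat u x = (\<chi> i j. inner (pd i (graph_map u) x) (pd j (graph_map u) x))"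

definition mean_curv :: "(real^'n::finite \<Rightarrow> real^'m::finite) \<Rightarrow> real^'n \<Rightarrow> (real^'n) \<times> (real^'m)" where
  "mean_curv u x = (\<Sum>i\<in>UNIV. \<Sum>j\<in>UNIV.
      (matrix_inv (gmat u x) $ i $ j) *\<^sub>R nproj u x (pd i (pd j (graph_map u)) x))"

definition self_shrinker :: "(real^'n::finite \<Rightarrow> real^'m::finite) \<Rightarrow> bool" where
  "self_shrinker u \<longleftrightarrow> (\<forall>x. mean_curv u x = - (1/2) *\<^sub>R nproj u x (graph_map u x))"

definition normal_field :: "(real^'n::finite \<Rightarrow> real^'m::finite) \<Rightarrow> (real^'n \<Rightarrow> (real^'n) \<times> (real^'m)) \<Rightarrow> bool" where
  "normal_field u \<xi> \<longleftrightarrow> smooth_map \<xi> \<and> (\<forall>x i. inner (\<xi> x) (pd i (graph_map u) x) = 0)"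

definition nabla_perp :: "(real^'n::finite \<Rightarrow> real^'m::finite) \<Rightarrow> 'n \<Rightarrow> (real^'n \<Rightarrow> (real^'n) \<times> (real^'m)) \<Rightarrow> real^'n \<Rightarrow> (real^'n) \<times> (real^'m)" where
  "nabla_perp u i \<xi> x = nproj u x (pd i \<xi> x)"

text \<open>Flat normal bundle: R^perp(d_i, d_j) xi = nabla_i nabla_j xi - nabla_j nabla_i xi = 0
  (coordinate fields commute) for all smooth normal fields xi.\<close>
definition flat_normal_bundle :: "(real^'n::finite \<Rightarrow> real^'m::finite) \<Rightarrow> bool" where
  "flat_normal_bundle u \<longleftrightarrow> (\<forall>\<xi> i j x. normal_field u \<xi> \<longrightarrow>
      nabla_perp u i (nabla_perp u j \<xi>) x = nabla_perp u j (nabla_perp u i \<xi>) x)"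

end

theory Submission
  imports Defs
begin

text \<open>Write \<open>g\<close> for the induced metric of the graph, \<open>B\<close> for its second fundamental form and
  \<open>L f = g\<^sup>i\<^sup>j f\<^sub>i\<^sub>j - x \<cdot> D f / 2\<close> for the drift Laplacian in graph coordinates; the self-shrinker equation
  becomes \<open>L u = - u / 2\<close>. If the normal bundle is flat, the shape operators commute, and then
  \<open>w = (det g)\<close> to the power \<open>-1/2\<close> satisfies \<open>L w = - |B|\<^sup>2 w \<le> 0\<close>. Since
  \<open>L |x|\<^sup>2 \<le> 2 n - |x|\<^sup>2\<close>, comparison of \<open>w > 0\<close> with \<open>|x|\<^sup>2\<close> outside the ball of radius
  \<open>sqrt (2 n)\<close> shows that \<open>w\<close> attains its global minimum there. The strong minimum principle
  makes \<open>w\<close> constant, so \<open>B = 0\<close>, \<open>u\<close> is affine, and the self-shrinker equation makes it linear.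
  No volume growth estimate is needed.\<close>

section \<open>Partial derivatives\<close>

text \<open>The operator has its simple form because of the shrinker equation: on \<open>M\<close>,
  the Laplacian minus half the derivative along the tangential part of the position vector sends
  every ambient coordinate function to minus half of itself. The second-order chain rule in the
  coordinates \<open>x\<close> then leaves the inverse metric as leading coefficient and
  \<open>- x / 2\<close> as drift, with no Christoffel symbols. The exponent comes from a
  cancellation. For \<open>phi = (1/2) ln (det g)\<close> flatness gives
  \<open>L phi = |B|^2 + |grad phi|^2\<close>, so \<open>L\<close> sends
  \<open>exp (- p * phi)\<close> to
  \<open>- p * exp (- p * phi) * (|B|^2 + (1 - p) * |grad phi|^2)\<close>; \<open>p = 1\<close>
  removes the gradient term. The obstacle is that \<open>M\<close> is not compact, so a positive
  supersolution might approach its infimum only at infinity. A small multiple of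
  \<open>|x|^2\<close> prevents this: the sum is proper, and far out the drift makes it a strict
  supersolution.\<close>

definition has_pd :: "'n::finite \<Rightarrow> (real^'n \<Rightarrow> 'b::real_normed_vector) \<Rightarrow> 'b \<Rightarrow> real^'n \<Rightarrow> bool" where
  "has_pd i f f' x \<longleftrightarrow> ((\<lambda>t. f (x + t *\<^sub>R axis i 1)) has_vector_derivative f') (at 0)"

text \<open>\<open>pd\<close> is a total operator whose value carries no information where no
  derivative exists. The calculus is therefore done with the relation \<open>has_pd\<close>, and
  read back into \<open>pd\<close> here.\<close>

lemma pd_eqI: "has_pd i f f' x \<Longrightarrow> pd i f x = f'"
  unfolding has_pd_def pd_def by (rule vector_derivative_at)

lemma has_pd_unique: "has_pd i f a x \<Longrightarrow> has_pd i f b x \<Longrightarrow> a = b"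
  using pd_eqI by blast

lemma has_pd_const: "has_pd i (\<lambda>x. c) 0 x"
  by (simp add: has_pd_def)

lemma has_pd_bounded_linear:
  "bounded_linear L \<Longrightarrow> has_pd i f f' x \<Longrightarrow> has_pd i (\<lambda>x. L (f x)) (L f') x"
  unfolding has_pd_def by (rule bounded_linear.has_vector_derivative)

lemma has_pd_add: "has_pd i f f' x \<Longrightarrow> has_pd i g g' x \<Longrightarrow> has_pd i (\<lambda>x. f x + g x) (f' + g') x"
  unfolding has_pd_def by (rule has_vector_derivative_add)

lemma has_pd_diff: "has_pd i f f' x \<Longrightarrow> has_pd i g g' x \<Longrightarrow> has_pd i (\<lambda>x. f x - g x) (f' - g') x"
  unfolding has_pd_def by (rule has_vector_derivative_diff)

lemma has_pd_minus: "has_pd i f f' x \<Longrightarrow> has_pd i (\<lambda>x. - f x) (- f') x"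
  unfolding has_pd_def by (rule has_vector_derivative_minus)

lemma has_pd_sum:
  "(\<And>k. k \<in> I \<Longrightarrow> has_pd i (f k) (f' k) x) \<Longrightarrow> has_pd i (\<lambda>x. \<Sum>k\<in>I. f k x) (\<Sum>k\<in>I. f' k) x"
  unfolding has_pd_def by (rule has_vector_derivative_sum)

lemma has_pd_bilinear:
  assumes "bounded_bilinear B" "has_pd i f f' x" "has_pd i g g' x"
  shows "has_pd i (\<lambda>x. B (f x) (g x)) (B (f x) g' + B f' (g x)) x"
  using bounded_bilinear.has_vector_derivative[OF assms(1) assms(2,3)[unfolded has_pd_def]]
  by (simp add: has_pd_def)

lemmas has_pd_mult = has_pd_bilinear[OF bounded_bilinear_mult]
lemmas has_pd_inner = has_pd_bilinear[OF bounded_bilinear_inner]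
lemmas has_pd_scaleR = has_pd_bilinear[OF bounded_bilinear_scaleR]

lemma has_pd_Pair:
  "has_pd i f f' x \<Longrightarrow> has_pd i g g' x \<Longrightarrow> has_pd i (\<lambda>x. (f x, g x)) (f', g') x"
  unfolding has_pd_def by (rule has_vector_derivative_Pair)

lemma has_pd_id: "has_pd i (\<lambda>x. x) (axis i 1) x"
  unfolding has_pd_def by (auto intro!: derivative_eq_intros)

lemma has_pd_nth: "has_pd i (\<lambda>x. x $ k) (if k = i then 1 else 0) x"
  using has_pd_bounded_linear[OF bounded_linear_vec_nth[of k] has_pd_id[of i x]]
  by (simp add: axis_def)

lemma has_pd_real: "has_pd i f f' x \<longleftrightarrow> ((\<lambda>t. f (x + t *\<^sub>R axis i 1)) has_real_derivative f') (at 0)"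
  by (simp add: has_pd_def has_real_derivative_iff_has_vector_derivative)

lemma has_pd_chain:
  assumes "has_pd i f f' x" "(\<phi> has_real_derivative d) (at (f x))"
  shows "has_pd i (\<lambda>x. \<phi> (f x)) (d * f') x"
  using DERIV_chain2[of \<phi> d "\<lambda>t. f (x + t *\<^sub>R axis i 1)" 0 f' UNIV] assms
  by (simp add: has_pd_real)

lemma has_pd_along_axis:
  fixes f :: "real^'n::finite \<Rightarrow> real"
  assumes "has_pd i f f' (x + s *\<^sub>R axis i 1)"
  shows "((\<lambda>t. f (x + t *\<^sub>R axis i 1)) has_real_derivative f') (at s)"
proof -
  have "((\<lambda>t. f (x + (t + s) *\<^sub>R axis i 1)) has_real_derivative f') (at 0)"
    using assms by (simp only: has_pd_real scaleR_add_left add_ac)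
  then have "((\<lambda>t. f (x + t *\<^sub>R axis i 1)) has_real_derivative f') (at (0 + s))"
    by (rule DERIV_shift[THEN iffD2])
  then show ?thesis by (simp only: add_0)
qed

lemma smooth_has_pd:
  assumes "smooth_map f"
  shows "has_pd i (pds is f) (pds (i # is) f x) x"
proof -
  have "(\<lambda>t. pds is f (x + t *\<^sub>R axis i 1)) differentiable (at 0)"
    using assms by (simp add: smooth_map_def)
  then show ?thesis
    by (simp add: has_pd_def pd_def vector_derivative_works)
qed

lemma smooth_continuous: "smooth_map f \<Longrightarrow> continuous_on UNIV (pds is f)"
  by (simp add: smooth_map_def)

section \<open>Symmetry of mixed partials and total differentiability\<close>

lemma mixed_difference_mean_value:
  fixes f :: "real^'n::finite \<Rightarrow> real"
  assumes "s > 0" and fi: "\<And>x. has_pd i f (fi x) x" and fij: "\<And>x. has_pd j fi (fij x) x"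
  obtains \<theta> \<eta> where "0 < \<theta>" "\<theta> < s" "0 < \<eta>" "\<eta> < s"
    "f (x + s *\<^sub>R axis i 1 + s *\<^sub>R axis j 1) - f (x + s *\<^sub>R axis i 1) - f (x + s *\<^sub>R axis j 1) + f x
      = s * s * fij (x + \<theta> *\<^sub>R axis i 1 + \<eta> *\<^sub>R axis j 1)"
proof -
  let ?\<phi> = "\<lambda>t. f ((x + s *\<^sub>R axis j 1) + t *\<^sub>R axis i 1) - f (x + t *\<^sub>R axis i 1)"
  have "DERIV ?\<phi> t :> fi ((x + s *\<^sub>R axis j 1) + t *\<^sub>R axis i 1) - fi (x + t *\<^sub>R axis i 1)" for t
    by (intro DERIV_diff has_pd_along_axis fi)
  from MVT2[of 0 s, OF \<open>s > 0\<close> this] obtain \<theta> where \<theta>: "0 < \<theta>" "\<theta> < s"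
    and 1: "?\<phi> s - ?\<phi> 0 = s * (fi ((x + s *\<^sub>R axis j 1) + \<theta> *\<^sub>R axis i 1) - fi (x + \<theta> *\<^sub>R axis i 1))"
    by auto
  have "DERIV (\<lambda>t. fi ((x + \<theta> *\<^sub>R axis i 1) + t *\<^sub>R axis j 1)) t :>
      fij ((x + \<theta> *\<^sub>R axis i 1) + t *\<^sub>R axis j 1)" for t
    by (intro has_pd_along_axis fij)
  from MVT2[of 0 s, OF \<open>s > 0\<close> this] obtain \<eta> where \<eta>: "0 < \<eta>" "\<eta> < s"
    and 2: "fi ((x + \<theta> *\<^sub>R axis i 1) + s *\<^sub>R axis j 1) - fi (x + \<theta> *\<^sub>R axis i 1)
       = s * fij (x + \<theta> *\<^sub>R axis i 1 + \<eta> *\<^sub>R axis j 1)"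
    by auto
  show thesis
    using that[OF \<theta> \<eta>] 1 2 by (simp add: algebra_simps)
qed

text \<open>Schwarz's theorem by second differences: the alternating sum over the corners of a
  square does not depend on the order of the axes, and the mean value theorem, applied in either
  order, turns it into \<open>s * s\<close> times a mixed partial at a nearby point.\<close>

lemma mixed_partials_commute_real:
  fixes f :: "real^'n::finite \<Rightarrow> real"
  assumes fi: "\<And>x. has_pd i f (fi x) x" and fij: "\<And>x. has_pd j fi (fij x) x"
    and fj: "\<And>x. has_pd j f (fj x) x" and fji: "\<And>x. has_pd i fj (fji x) x"
    and cont: "continuous_on UNIV fij" "continuous_on UNIV fji"
  shows "fij x = fji x"
proof (rule ccontr)
  assume "fij x \<noteq> fji x"
  \<comment> \<open>Half the gap, so that values strictly within \<open>e\<close> of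
    \<open>fij x\<close> and \<open>fji x\<close> cannot coincide.\<close>
  define e where "e = \<bar>fij x - fji x\<bar> / 2"
  have "e > 0" using \<open>fij x \<noteq> fji x\<close> by (simp add: e_def)
  obtain d1 where d1: "d1 > 0" "\<And>y. dist y x < d1 \<Longrightarrow> dist (fij y) (fij x) < e"
    using cont(1) \<open>e > 0\<close> by (metis UNIV_I continuous_on_iff)
  obtain d2 where d2: "d2 > 0" "\<And>y. dist y x < d2 \<Longrightarrow> dist (fji y) (fji x) < e"
    using cont(2) \<open>e > 0\<close> by (metis UNIV_I continuous_on_iff)
  \<comment> \<open>Both displacements are below \<open>s\<close>, so their sum stays below
    \<open>min d1 d2\<close>.\<close>
  define s where "s = min d1 d2 / 2"
  have "s > 0" using d1 d2 by (simp add: s_def)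
  have near: "dist (x + \<theta> *\<^sub>R axis k 1 + \<eta> *\<^sub>R axis l 1) x < min d1 d2"
    if "0 < \<theta>" "\<theta> < s" "0 < \<eta>" "\<eta> < s" for \<theta> \<eta> and k l :: 'n
  proof -
    have "dist (x + \<theta> *\<^sub>R axis k 1 + \<eta> *\<^sub>R axis l 1) x = norm (\<theta> *\<^sub>R (axis k 1::real^'n) + \<eta> *\<^sub>R axis l 1)"
      by (simp add: dist_norm add.assoc)
    also have "\<dots> \<le> \<theta> + \<eta>"
      by (rule order_trans[OF norm_triangle_ineq]) (use that in simp)
    also have "\<dots> < min d1 d2" using that by (simp add: s_def)
    finally show ?thesis .
  qed
  obtain \<theta> \<eta> where A: "0 < \<theta>" "\<theta> < s" "0 < \<eta>" "\<eta> < s"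
    "f (x + s *\<^sub>R axis i 1 + s *\<^sub>R axis j 1) - f (x + s *\<^sub>R axis i 1) - f (x + s *\<^sub>R axis j 1) + f x
      = s * s * fij (x + \<theta> *\<^sub>R axis i 1 + \<eta> *\<^sub>R axis j 1)"
    using mixed_difference_mean_value[OF \<open>s > 0\<close> fi fij] by blast
  obtain \<theta>' \<eta>' where B: "0 < \<theta>'" "\<theta>' < s" "0 < \<eta>'" "\<eta>' < s"
    "f (x + s *\<^sub>R axis j 1 + s *\<^sub>R axis i 1) - f (x + s *\<^sub>R axis j 1) - f (x + s *\<^sub>R axis i 1) + f x
      = s * s * fji (x + \<theta>' *\<^sub>R axis j 1 + \<eta>' *\<^sub>R axis i 1)"
    using mixed_difference_mean_value[OF \<open>s > 0\<close> fj fji] by blast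
  have "s * s * fij (x + \<theta> *\<^sub>R axis i 1 + \<eta> *\<^sub>R axis j 1) = s * s * fji (x + \<theta>' *\<^sub>R axis j 1 + \<eta>' *\<^sub>R axis i 1)"
    using A(5) B(5) by (simp add: algebra_simps)
  then have "fij (x + \<theta> *\<^sub>R axis i 1 + \<eta> *\<^sub>R axis j 1) = fji (x + \<theta>' *\<^sub>R axis j 1 + \<eta>' *\<^sub>R axis i 1)"
    using \<open>s > 0\<close> by simp
  moreover have "dist (fij (x + \<theta> *\<^sub>R axis i 1 + \<eta> *\<^sub>R axis j 1)) (fij x) < e"
    using near[OF A(1-4)] d1(2) by simp
  moreover have "dist (fji (x + \<theta>' *\<^sub>R axis j 1 + \<eta>' *\<^sub>R axis i 1)) (fji x) < e"
    using near[OF B(1-4)] d2(2) by simp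
  ultimately show False unfolding e_def dist_real_def by argo
qed

lemma smooth_mixed_partials_commute:
  fixes f :: "real^'n::finite \<Rightarrow> 'b::real_inner"
  assumes "smooth_map f"
  shows "pds (i # j # is) f x = pds (j # i # is) f x"
proof -
  have pd: "has_pd k (\<lambda>x. pds js f x \<bullet> a) (pds (k # js) f x \<bullet> a) x" for x k js a
    by (rule has_pd_bounded_linear[OF bounded_linear_inner_left]) (rule smooth_has_pd[OF assms])
  have cont: "continuous_on UNIV (\<lambda>x. pds js f x \<bullet> a)" for js a
    by (intro continuous_intros smooth_continuous assms)
  have "pds (i # j # is) f x \<bullet> a = pds (j # i # is) f x \<bullet> a" for a
    by (rule mixed_partials_commute_real[OF pd pd pd pd cont cont])
  then show ?thesis
    by (metis vector_eq_rdot)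
qed

text \<open>\<open>smooth_map\<close> differentiates along axes only; the total derivative later
  gives access to all directions. The path from \<open>x\<close> to \<open>x + h\<close> is walked
  one axis at a time, and continuity of the partials controls the error of each leg.\<close>

lemma has_derivative_continuous_partials:
  fixes f :: "real^'n::finite \<Rightarrow> real"
  assumes f: "\<And>i x. has_pd i f (f' i x) x" and cont: "\<And>i. continuous_on UNIV (f' i)"
  shows "(f has_derivative (\<lambda>h. \<Sum>i\<in>UNIV. h $ i * f' i x)) (at x)"
  unfolding has_derivative_at_alt
proof (intro conjI allI impI)
  show "bounded_linear (\<lambda>h. \<Sum>i\<in>UNIV. h $ i * f' i x)"
    by (intro bounded_linear_sum bounded_linear_mult_const bounded_linear_vec_nth)
  fix e :: real assume "e > 0"
  \<comment> \<open>The errors of the legs add up to \<open>e'\<close> times the sum of the absolute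
    values of the components of \<open>h\<close>, which is at most
    \<open>CARD('n) * norm h\<close>.\<close>
  define e' where "e' = e / real CARD('n)"
  have "e' > 0" using \<open>e > 0\<close> by (simp add: e'_def)
  have "\<forall>i. \<exists>d>0. \<forall>y. dist y x < d \<longrightarrow> dist (f' i y) (f' i x) < e'"
    using cont \<open>e' > 0\<close> by (metis UNIV_I continuous_on_iff)
  then obtain \<delta> where \<delta>: "\<And>i. \<delta> i > 0" "\<And>i y. dist y x < \<delta> i \<Longrightarrow> dist (f' i y) (f' i x) < e'"
    by metis
  define d where "d = Min (range \<delta>)"
  have "d > 0" using \<delta>(1) by (simp add: d_def)
  have d: "dist (f' i y) (f' i x) < e'" if "dist y x < d" for i y
    using that \<delta>(2)[of y i] by (simp add: d_def)
  have step: "\<bar>f (x + (\<Sum>i\<in>S. h $ i *\<^sub>R axis i 1)) - f x - (\<Sum>i\<in>S. h $ i * f' i x)\<bar> \<le> e' * (\<Sum>i\<in>S. \<bar>h $ i\<bar>)"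
    if "finite S" "norm h < d" for h and S :: "'n set"
    using that
  proof (induction S rule: finite_induct)
    case (insert j S)
    define z where "z = x + (\<Sum>i\<in>S. h $ i *\<^sub>R axis i 1)"
    let ?\<phi> = "\<lambda>t. f (z + t *\<^sub>R axis j 1) - t * f' j x"
    have "norm (?\<phi> (h $ j) - ?\<phi> 0) \<le> e' * norm (h $ j - 0)"
    proof (rule field_differentiable_bound)
      fix t assume "t \<in> closed_segment 0 (h $ j)"
      then have t: "\<bar>t\<bar> \<le> \<bar>h $ j\<bar>" by (auto simp: closed_segment_eq_real_ivl split: if_splits)
      show "(?\<phi> has_real_derivative (f' j (z + t *\<^sub>R axis j 1) - f' j x)) (at t within closed_segment 0 (h $ j))"
        by (rule has_field_derivative_at_within, rule DERIV_diff[OF has_pd_along_axis[OF f]])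
          (auto intro!: derivative_eq_intros)
      \<comment> \<open>Each component of the displacement is zero, a component of \<open>h\<close>,
        or \<open>t\<close>, so the partial paths never leave the ball of radius
        \<open>norm h\<close>.\<close>
      have "norm ((\<Sum>i\<in>S. h $ i *\<^sub>R axis i 1) + t *\<^sub>R axis j 1 :: real^'n) \<le> norm h"
      proof (rule norm_le_componentwise_cart)
        fix k
        show "norm (((\<Sum>i\<in>S. h $ i *\<^sub>R axis i 1) + t *\<^sub>R axis j 1 :: real^'n) $ k) \<le> norm (h $ k)"
        proof -
          have "(\<Sum>i\<in>S. h $ i *\<^sub>R axis i 1 :: real^'n) $ k = (\<Sum>i\<in>S. if k = i then h $ i else 0)"
            unfolding sum_component by (intro sum.cong) (auto simp: axis_def)
          also have "\<dots> = (if k \<in> S then h $ k else 0)"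
            using insert.hyps(1) by simp
          finally show ?thesis
            using insert.hyps t by (auto simp: axis_def)
        qed
      qed
      then have "dist (z + t *\<^sub>R axis j 1) x < d"
        using insert.prems by (simp add: z_def dist_norm add.assoc)
      then show "norm (f' j (z + t *\<^sub>R axis j 1) - f' j x) \<le> e'"
        using d[of "z + t *\<^sub>R axis j 1" j] by (simp add: dist_norm)
    qed auto
    then have "\<bar>f (z + h $ j *\<^sub>R axis j 1) - f z - h $ j * f' j x\<bar> \<le> e' * \<bar>h $ j\<bar>"
      by (simp add: algebra_simps)
    moreover have "\<bar>f z - f x - (\<Sum>i\<in>S. h $ i * f' i x)\<bar> \<le> e' * (\<Sum>i\<in>S. \<bar>h $ i\<bar>)"
      using insert unfolding z_def by simp
    moreover have "x + (\<Sum>i\<in>insert j S. h $ i *\<^sub>R axis i 1) = z + h $ j *\<^sub>R axis j 1"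
      using insert.hyps by (simp add: z_def)
    ultimately have "\<bar>f (x + (\<Sum>i\<in>insert j S. h $ i *\<^sub>R axis i 1)) - f x - (h $ j * f' j x + (\<Sum>i\<in>S. h $ i * f' i x))\<bar>
        \<le> e' * \<bar>h $ j\<bar> + e' * (\<Sum>i\<in>S. \<bar>h $ i\<bar>)"
      by simp
    then show ?case
      by (simp only: sum.insert[OF insert.hyps] distrib_left)
  qed simp
  show "\<exists>d>0. \<forall>y. norm (y - x) < d \<longrightarrow>
      norm (f y - f x - (\<Sum>i\<in>UNIV. (y - x) $ i * f' i x)) \<le> e * norm (y - x)"
  proof (intro exI conjI allI impI)
    fix y assume y: "norm (y - x) < d"
    have "(\<Sum>i\<in>UNIV. (y - x) $ i *\<^sub>R axis i 1) = y - x"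
      using basis_expansion[of "y - x"] by (simp add: scalar_mult_eq_scaleR)
    then have "norm (f y - f x - (\<Sum>i\<in>UNIV. (y - x) $ i * f' i x)) \<le> e' * (\<Sum>i\<in>UNIV. \<bar>(y - x) $ i\<bar>)"
      using step[of UNIV "y - x", OF finite y] by simp
    also have "(\<Sum>i\<in>UNIV. \<bar>(y - x) $ i\<bar>) \<le> (\<Sum>i\<in>(UNIV::'n set). norm (y - x))"
      by (intro sum_mono component_le_norm_cart)
    also have "e' * \<dots> = e * norm (y - x)" by (simp add: e'_def)
    finally show "norm (f y - f x - (\<Sum>i\<in>UNIV. (y - x) $ i * f' i x)) \<le> e * norm (y - x)"
      using \<open>e' > 0\<close> by simp
  qed (fact \<open>d > 0\<close>)
qed

section \<open>Minimum principles for drift operators\<close>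

text \<open>The derivatives are explicit data, so that a differential operator can be applied to
  formulas for them.\<close>

definition C2_with :: "(real^'n::finite \<Rightarrow> real) \<Rightarrow> ('n \<Rightarrow> real^'n \<Rightarrow> real) \<Rightarrow> ('n \<Rightarrow> 'n \<Rightarrow> real^'n \<Rightarrow> real) \<Rightarrow> bool" where
  "C2_with w w1 w2 \<longleftrightarrow>
     (\<forall>x. (w has_derivative (\<lambda>h. \<Sum>i\<in>UNIV. h $ i * w1 i x)) (at x)) \<and>
     (\<forall>i x. (w1 i has_derivative (\<lambda>h. \<Sum>j\<in>UNIV. h $ j * w2 i j x)) (at x))"

lemma C2_with_continuous: "C2_with w w1 w2 \<Longrightarrow> continuous_on S w"
  unfolding C2_with_def by (meson continuous_at_imp_continuous_on has_derivative_continuous)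

lemma C2_with_add_scaled:
  assumes "C2_with w w1 w2" "C2_with v v1 v2"
  shows "C2_with (\<lambda>x. w x + c * v x) (\<lambda>i x. w1 i x + c * v1 i x) (\<lambda>i j x. w2 i j x + c * v2 i j x)"
  using assms unfolding C2_with_def
  by (auto intro!: derivative_eq_intros simp: fun_eq_iff sum_distrib_left sum.distrib algebra_simps)

lemma C2_with_line:
  assumes "C2_with w w1 w2"
  shows "((\<lambda>t. w (x + t *\<^sub>R d)) has_real_derivative (\<Sum>i\<in>UNIV. d $ i * w1 i (x + t *\<^sub>R d))) (at t)"
    and "((\<lambda>t. \<Sum>i\<in>UNIV. d $ i * w1 i (x + t *\<^sub>R d)) has_real_derivative
           (\<Sum>i\<in>UNIV. \<Sum>j\<in>UNIV. d $ i * d $ j * w2 i j (x + t *\<^sub>R d))) (at t)"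
proof -
  have lin: "((\<lambda>t. x + t *\<^sub>R d) has_derivative (\<lambda>s. s *\<^sub>R d)) (at t)"
    by (auto intro!: derivative_eq_intros)
  have "(w has_derivative (\<lambda>h. \<Sum>i\<in>UNIV. h $ i * w1 i (x + t *\<^sub>R d))) (at (x + t *\<^sub>R d))"
    using assms by (simp add: C2_with_def)
  from has_derivative_compose[OF lin this]
  show "((\<lambda>t. w (x + t *\<^sub>R d)) has_real_derivative (\<Sum>i\<in>UNIV. d $ i * w1 i (x + t *\<^sub>R d))) (at t)"
    unfolding has_field_derivative_def
    by (rule has_derivative_eq_rhs) (simp add: fun_eq_iff sum_distrib_left algebra_simps)
  have "((\<lambda>t. w1 i (x + t *\<^sub>R d)) has_real_derivative (\<Sum>j\<in>UNIV. d $ j * w2 i j (x + t *\<^sub>R d))) (at t)" for i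
  proof -
    have "(w1 i has_derivative (\<lambda>h. \<Sum>j\<in>UNIV. h $ j * w2 i j (x + t *\<^sub>R d))) (at (x + t *\<^sub>R d))"
      using assms by (simp add: C2_with_def)
    from has_derivative_compose[OF lin this] show ?thesis
      unfolding has_field_derivative_def
      by (rule has_derivative_eq_rhs) (simp add: fun_eq_iff sum_distrib_left algebra_simps)
  qed
  then have "((\<lambda>t. \<Sum>i\<in>UNIV. d $ i * w1 i (x + t *\<^sub>R d)) has_real_derivative
           (\<Sum>i\<in>UNIV. d $ i * (\<Sum>j\<in>UNIV. d $ j * w2 i j (x + t *\<^sub>R d)))) (at t)"
    by (intro DERIV_sum DERIV_cmult)
  then show "((\<lambda>t. \<Sum>i\<in>UNIV. d $ i * w1 i (x + t *\<^sub>R d)) has_real_derivative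
           (\<Sum>i\<in>UNIV. \<Sum>j\<in>UNIV. d $ i * d $ j * w2 i j (x + t *\<^sub>R d))) (at t)"
    by (simp add: sum_distrib_left mult.assoc)
qed

text \<open>A negative second derivative at a critical point makes \<open>f'\<close> negative just
  to the right of it, so \<open>f\<close> would fall below its minimum.\<close>

lemma local_min_derivatives:
  fixes f f' :: "real \<Rightarrow> real"
  assumes f: "\<And>t. (f has_real_derivative f' t) (at t)" and f': "(f' has_real_derivative c) (at 0)"
    and "\<delta> > 0" and min: "\<And>t. \<bar>t\<bar> < \<delta> \<Longrightarrow> f 0 \<le> f t"
  shows "f' 0 = 0" "c \<ge> 0"
proof -
  show 0: "f' 0 = 0"
    using DERIV_local_min[OF f \<open>\<delta> > 0\<close>, of 0] min by simp
  show "c \<ge> 0"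
  proof (rule ccontr)
    assume "\<not> c \<ge> 0"
    then obtain d where d: "d > 0" "\<And>h. 0 < h \<Longrightarrow> h < d \<Longrightarrow> f' h < 0"
      using DERIV_neg_dec_right[OF f'] 0 by force
    define s where "s = min d \<delta> / 2"
    have s: "0 < s" "s < d" "s < \<delta>" using d \<open>\<delta> > 0\<close> by (auto simp: s_def)
    obtain z where "0 < z" "z < s" "f s - f 0 = (s - 0) * f' z"
      using MVT2[of 0 s f f'] s(1) f by blast
    then have "f s - f 0 < 0" using s d(2)[of z] by (simp add: mult_pos_neg)
    then show False using min[of s] s by simp
  qed
qed

text \<open>The second-order coefficients are given as a Gram matrix, so that the operator is a sum of
  second directional derivatives plus drift.\<close>

locale drift_operator =
  fixes F :: "'n::finite \<Rightarrow> real^'n \<Rightarrow> 'e::euclidean_space" and b :: "'n \<Rightarrow> real^'n \<Rightarrow> real"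
  assumes F_cont: "continuous_on UNIV (F i)" and b_cont: "continuous_on UNIV (b i)"
begin

definition L :: "('n \<Rightarrow> real^'n \<Rightarrow> real) \<Rightarrow> ('n \<Rightarrow> 'n \<Rightarrow> real^'n \<Rightarrow> real) \<Rightarrow> real^'n \<Rightarrow> real" where
  "L w1 w2 x = (\<Sum>i\<in>UNIV. \<Sum>j\<in>UNIV. (F i x \<bullet> F j x) * w2 i j x) + (\<Sum>i\<in>UNIV. b i x * w1 i x)"

lemma L_add_scaled:
  "L (\<lambda>i x. w1 i x + c * v1 i x) (\<lambda>i j x. w2 i j x + c * v2 i j x) x = L w1 w2 x + c * L v1 v2 x"
  by (simp add: L_def sum_distrib_left sum.distrib algebra_simps)

text \<open>In an orthonormal basis the Gram matrix is a sum of rank-one matrices, so the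
  second-order part is a sum of second derivatives along the directions with components
  \<open>F i p \<bullet> s\<close>. Each is nonnegative at a minimum, and the drift term vanishes
  with the gradient.\<close>

lemma L_nonneg_at_local_min:
  assumes C2: "C2_with w w1 w2" and "\<delta> > 0" and min: "\<And>y. dist y p < \<delta> \<Longrightarrow> w p \<le> w y"
  shows "L w1 w2 p \<ge> 0"
proof -
  have dir: "(\<Sum>i\<in>UNIV. d $ i * w1 i p) = 0 \<and> (\<Sum>i\<in>UNIV. \<Sum>j\<in>UNIV. d $ i * d $ j * w2 i j p) \<ge> 0" for d
  proof -
    \<comment> \<open>The added one covers the direction \<open>d = 0\<close>.\<close>
    define \<epsilon> where "\<epsilon> = \<delta> / (norm d + 1)"
    have "\<epsilon> > 0" using \<open>\<delta> > 0\<close> by (simp add: \<epsilon>_def add_nonneg_pos)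
    have "w (p + 0 *\<^sub>R d) \<le> w (p + t *\<^sub>R d)" if "\<bar>t\<bar> < \<epsilon>" for t
    proof -
      have "\<bar>t\<bar> * norm d \<le> \<bar>t\<bar> * (norm d + 1)" by (simp add: mult_left_mono)
      also have "\<dots> < \<delta>" using that by (simp add: \<epsilon>_def pos_less_divide_eq add_nonneg_pos)
      finally show ?thesis using min[of "p + t *\<^sub>R d"] by (simp add: dist_norm)
    qed
    from local_min_derivatives[OF C2_with_line(1)[OF C2, of p d] C2_with_line(2)[OF C2, of d p] \<open>\<epsilon> > 0\<close>, OF this]
    show ?thesis by simp
  qed
  have w1: "w1 i p = 0" for i
  proof -
    have "(\<Sum>k\<in>UNIV. axis i 1 $ k * w1 k p) = (\<Sum>k\<in>UNIV. if k = i then w1 k p else 0)"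
      by (intro sum.cong) (auto simp: axis_def)
    then show ?thesis using dir[of "axis i 1"] by simp
  qed
  have "F i p \<bullet> F j p = (\<Sum>s\<in>Basis. (F i p \<bullet> s) * (F j p \<bullet> s))" for i j
    by (rule euclidean_inner)
  then have "L w1 w2 p = (\<Sum>i\<in>UNIV. \<Sum>j\<in>UNIV. \<Sum>s\<in>Basis. (F i p \<bullet> s) * (F j p \<bullet> s) * w2 i j p)"
    by (simp add: L_def w1 sum_distrib_right)
  also have "\<dots> = (\<Sum>i\<in>UNIV. \<Sum>s\<in>Basis. \<Sum>j\<in>UNIV. (F i p \<bullet> s) * (F j p \<bullet> s) * w2 i j p)"
    by (intro sum.cong refl sum.swap)
  also have "\<dots> = (\<Sum>s\<in>Basis. \<Sum>i\<in>UNIV. \<Sum>j\<in>UNIV. (F i p \<bullet> s) * (F j p \<bullet> s) * w2 i j p)"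
    by (rule sum.swap)
  also have "\<dots> \<ge> 0"
    by (rule sum_nonneg) (use dir[of "\<chi> i. F i p \<bullet> _"] in simp)
  finally show ?thesis .
qed

end

lemma C2_with_norm_sq:
  "C2_with (\<lambda>x::real^'n::finite. x \<bullet> x) (\<lambda>i x. 2 * x $ i) (\<lambda>i j x. if i = j then 2 else 0)"
  unfolding C2_with_def
proof (intro conjI allI)
  show "((\<lambda>x. x \<bullet> x) has_derivative (\<lambda>h. \<Sum>i\<in>UNIV. h $ i * (2 * x $ i))) (at x)" for x :: "real^'n"
    by (rule has_derivative_eq_rhs[OF has_derivative_inner[OF has_derivative_ident has_derivative_ident]])
      (auto simp: fun_eq_iff inner_vec_def algebra_simps sum.distrib[symmetric])
  have "((\<lambda>x. 2 * x $ i) has_derivative (\<lambda>h. 2 * h $ i)) (at x)" for x :: "real^'n" and i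
    by (intro has_derivative_mult_right bounded_linear.has_derivative[OF bounded_linear_vec_nth] has_derivative_ident)
  moreover have "(\<Sum>j\<in>UNIV. h $ j * (if i = j then 2 else 0)) = 2 * h $ i" for h :: "real^'n" and i
    by (simp add: if_distrib cong: if_cong)
  ultimately show "((\<lambda>x. 2 * x $ i) has_derivative (\<lambda>h. \<Sum>j\<in>UNIV. h $ j * (if i = j then 2 else 0))) (at x)"
    for i and x :: "real^'n"
    by simp
qed

text \<open>Hopf's barrier: for large \<open>\<alpha>\<close> the term with the square of
  \<open>\<alpha>\<close> dominates away from the centre \<open>y\<close>, which makes the Gaussian
  a strict subsolution of an elliptic operator there.\<close>

lemma C2_with_gaussian:
  fixes y :: "real^'n::finite" and \<alpha> :: real
  defines "h \<equiv> \<lambda>x. exp (- \<alpha> * ((x - y) \<bullet> (x - y)))"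
  shows "C2_with h (\<lambda>i x. - 2 * \<alpha> * (x - y) $ i * h x)
    (\<lambda>i j x. (4 * \<alpha>\<^sup>2 * (x - y) $ i * (x - y) $ j - (if i = j then 2 * \<alpha> else 0)) * h x)"
  unfolding C2_with_def
proof (intro conjI allI)
  have sq: "((\<lambda>x. (x - y) \<bullet> (x - y)) has_derivative (\<lambda>h. 2 * (h \<bullet> (x - y)))) (at x)" for x
    by (auto intro!: derivative_eq_intros simp: fun_eq_iff inner_commute)
  have D: "(h has_derivative (\<lambda>k. - 2 * \<alpha> * (k \<bullet> (x - y)) * h x)) (at x)" for x
    unfolding h_def
    by (rule has_derivative_eq_rhs[OF has_derivative_exp[OF has_derivative_mult_right[OF sq]]])
      (simp add: fun_eq_iff)
  then show "(h has_derivative (\<lambda>k. \<Sum>i\<in>UNIV. k $ i * (- 2 * \<alpha> * (x - y) $ i * h x))) (at x)" for x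
    by (rule has_derivative_eq_rhs)
      (simp add: fun_eq_iff inner_vec_def sum_distrib_left sum_distrib_right algebra_simps)
  fix i x
  have "((\<lambda>x. (x - y) $ i) has_derivative (\<lambda>k. k $ i)) (at x)"
    by (rule has_derivative_eq_rhs[OF bounded_linear.has_derivative[OF bounded_linear_vec_nth]])
      (auto intro!: derivative_eq_intros)
  from has_derivative_mult[OF has_derivative_mult_right[OF this, of "- 2 * \<alpha>"] D]
  show "((\<lambda>x. - 2 * \<alpha> * (x - y) $ i * h x) has_derivative
    (\<lambda>k. \<Sum>j\<in>UNIV. k $ j * ((4 * \<alpha>\<^sup>2 * (x - y) $ i * (x - y) $ j - (if i = j then 2 * \<alpha> else 0)) * h x))) (at x)"
  proof (rule has_derivative_eq_rhs, intro ext)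
    fix k :: "real^'n"
    have "(\<Sum>j\<in>UNIV. k $ j * ((4 * \<alpha>\<^sup>2 * (x - y) $ i * (x - y) $ j - (if i = j then 2 * \<alpha> else 0)) * h x))
      = (\<Sum>j\<in>UNIV. 4 * \<alpha>\<^sup>2 * (x - y) $ i * h x * (k $ j * (x - y) $ j) - (if i = j then 2 * \<alpha> * k $ j * h x else 0))"
      by (intro sum.cong) (auto simp: algebra_simps)
    also have "\<dots> = 4 * \<alpha>\<^sup>2 * (x - y) $ i * h x * (k \<bullet> (x - y)) - 2 * \<alpha> * k $ i * h x"
      by (simp add: sum_subtractf sum_distrib_left[symmetric] inner_vec_def)
    finally show "- 2 * \<alpha> * (x - y) $ i * (- 2 * \<alpha> * (k \<bullet> (x - y)) * h x) + - 2 * \<alpha> * k $ i * h x =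
      (\<Sum>j\<in>UNIV. k $ j * ((4 * \<alpha>\<^sup>2 * (x - y) $ i * (x - y) $ j - (if i = j then 2 * \<alpha> else 0)) * h x))"
      by (simp add: algebra_simps power2_eq_square)
  qed
qed

context drift_operator
begin

text \<open>Hopf's argument, with the contradiction read off an interior minimum instead of a normal
  derivative: near a point where a ball touches the set of minimum points, \<open>w\<close> minus a
  small multiple of the barrier has a local minimum, although \<open>L\<close> is negative on
  it.\<close>

lemma strong_minimum_principle:
  assumes C2: "C2_with w w1 w2" and super: "\<And>x. L w1 w2 x \<le> 0"
    and elliptic: "\<And>x \<xi>. (\<Sum>i\<in>UNIV. \<xi> $ i *\<^sub>R F i x) = 0 \<Longrightarrow> \<xi> = 0"
    and min: "\<And>x. w x0 \<le> w x"
  shows "w x = w x0"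
proof (rule ccontr)
  assume "w x \<noteq> w x0"
  define m where "m = w x0"
  define Z where "Z = {z. w z = m}"
  have wcont: "continuous_on S w" for S using C2_with_continuous[OF C2] .
  have "closed Z"
    unfolding Z_def using continuous_closed_preimage_constant[OF wcont[of UNIV] closed_UNIV, of m] by simp
  have "Z \<noteq> {}" by (auto simp: Z_def m_def)
  obtain x1 where x1: "x1 \<in> Z" and closest: "\<And>z. z \<in> Z \<Longrightarrow> dist x x1 \<le> dist x z"
    using distance_attains_inf[OF \<open>closed Z\<close> \<open>Z \<noteq> {}\<close>, of x] by blast
  \<comment> \<open>Halving the ball makes it touch \<open>Z\<close> at \<open>x1\<close> only.\<close>
  define y where "y = (1/2) *\<^sub>R (x + x1)"
  define \<xi> where "\<xi> = x1 - y"
  have "x \<noteq> x1" using x1 \<open>w x \<noteq> w x0\<close> by (auto simp: Z_def m_def)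
  have \<xi>: "\<xi> = (1/2) *\<^sub>R (x1 - x)" by (simp add: \<xi>_def y_def algebra_simps flip: scaleR_add_left)
  then have "\<xi> \<noteq> 0" using \<open>x \<noteq> x1\<close> by simp
  have touch: "w z > m" if "dist z y \<le> norm \<xi>" "z \<noteq> x1" for z
  proof (rule ccontr)
    assume "\<not> w z > m"
    then have "z \<in> Z" using min[of z] by (simp add: Z_def m_def)
    \<comment> \<open>As \<open>x1\<close> is a closest point of \<open>Z\<close> to
      \<open>x\<close>, the vector \<open>a + \<xi>\<close> is at least as long as
      \<open>2 *\<^sub>R \<xi>\<close>; since \<open>a\<close> is no longer than
      \<open>\<xi>\<close>, the parallelogram law forces \<open>a = \<xi>\<close>.\<close>
    define a where "a = z - y"
    have "norm (a + \<xi>) \<ge> norm (2 *\<^sub>R \<xi>)"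
    proof -
      have "y + y = x + x1" by (simp add: y_def flip: scaleR_add_left)
      then have "a + \<xi> = z - x" by (simp add: a_def \<xi>_def algebra_simps)
      moreover have "2 *\<^sub>R \<xi> = x1 - x" by (simp add: \<xi>)
      ultimately show ?thesis using closest[OF \<open>z \<in> Z\<close>] by (simp add: dist_norm norm_minus_commute)
    qed
    then have "(norm (2 *\<^sub>R \<xi>))\<^sup>2 \<le> (norm (a + \<xi>))\<^sup>2" by (intro power_mono) auto
    moreover have "(norm a)\<^sup>2 \<le> (norm \<xi>)\<^sup>2" using that(1) by (intro power_mono) (auto simp: a_def dist_norm)
    ultimately have "(norm (a - \<xi>))\<^sup>2 \<le> 0"
      by (simp add: power2_norm_eq_inner algebra_simps inner_commute)
    then have "a = \<xi>" by simp
    then show False using \<open>z \<noteq> x1\<close> by (simp add: a_def \<xi>_def)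
  qed
  define q where "q = (norm (\<Sum>i\<in>UNIV. \<xi> $ i *\<^sub>R F i x1))\<^sup>2"
  have "q > 0" using elliptic[of \<xi> x1] \<open>\<xi> \<noteq> 0\<close> by (auto simp: q_def)
  define C where "C = (\<Sum>i\<in>UNIV. F i x1 \<bullet> F i x1) + (\<Sum>i\<in>UNIV. b i x1 * \<xi> $ i)"
  \<comment> \<open>At \<open>x1\<close> the operator gives
    \<open>2 * \<alpha> * h x1 * (2 * (\<alpha> * q) - C)\<close>; this choice makes
    \<open>\<alpha> * q\<close> equal to \<open>\<bar>C\<bar> + 1\<close>, so the bracket is
    positive.\<close>
  define \<alpha> where "\<alpha> = (\<bar>C\<bar> + 1) / q"
  have "\<alpha> > 0" using \<open>q > 0\<close> by (simp add: \<alpha>_def)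
  define h where "h = (\<lambda>z. exp (- \<alpha> * ((z - y) \<bullet> (z - y))))"
  define h1 where "h1 = (\<lambda>i z. - 2 * \<alpha> * (z - y) $ i * h z)"
  define h2 where "h2 = (\<lambda>i j z. (4 * \<alpha>\<^sup>2 * (z - y) $ i * (z - y) $ j - (if i = j then 2 * \<alpha> else 0)) * h z)"
  have hC2: "C2_with h h1 h2"
    unfolding h1_def h2_def h_def by (rule C2_with_gaussian)
  have "L h1 h2 x1 > 0"
  proof -
    have "(\<Sum>i\<in>UNIV. \<Sum>j\<in>UNIV. (F i x1 \<bullet> F j x1) * h2 i j x1)
       = (\<Sum>i\<in>UNIV. \<Sum>j\<in>UNIV. 4 * \<alpha>\<^sup>2 * h x1 * (\<xi> $ i * (\<xi> $ j * (F i x1 \<bullet> F j x1))) -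
           (if i = j then 2 * \<alpha> * h x1 * (F i x1 \<bullet> F j x1) else 0))"
      unfolding h2_def \<xi>_def by (intro sum.cong) (auto simp: algebra_simps)
    also have "\<dots> = 4 * \<alpha>\<^sup>2 * h x1 * q - 2 * \<alpha> * h x1 * (\<Sum>i\<in>UNIV. F i x1 \<bullet> F i x1)"
      unfolding q_def power2_norm_eq_inner
      by (simp add: sum_subtractf sum_distrib_left inner_sum_left inner_sum_right mult_ac inner_commute)
    moreover have "(\<Sum>i\<in>UNIV. b i x1 * h1 i x1) = - 2 * \<alpha> * h x1 * (\<Sum>i\<in>UNIV. b i x1 * \<xi> $ i)"
      by (simp add: h1_def \<xi>_def sum_distrib_left algebra_simps sum_negf)
    ultimately have "L h1 h2 x1 = 2 * \<alpha> * h x1 * (2 * (\<alpha> * q) - C)"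
      by (simp add: L_def C_def algebra_simps power2_eq_square)
    moreover have "\<alpha> * q = \<bar>C\<bar> + 1" using \<open>q > 0\<close> by (simp add: \<alpha>_def)
    moreover have "h x1 > 0" by (simp add: h_def)
    ultimately show ?thesis using \<open>\<alpha> > 0\<close> by simp
  qed
  moreover have "continuous_on UNIV (L h1 h2)"
    unfolding L_def h1_def h2_def h_def
    by (intro continuous_intros F_cont b_cont) 
  ultimately have "open (L h1 h2 -` {0<..})" "x1 \<in> L h1 h2 -` {0<..}"
    by (auto simp: open_vimage)
  then obtain \<rho> where "\<rho> > 0" and \<rho>: "\<And>z. dist z x1 \<le> \<rho> \<Longrightarrow> L h1 h2 z > 0"
    unfolding open_contains_cball by (force simp: subset_eq dist_commute)
  \<comment> \<open>Only on this part of the small sphere can \<open>h\<close> exceed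
    \<open>h x1\<close>, and there compactness keeps \<open>w\<close> away from its minimum.
    \<open>K\<close> is empty if \<open>\<rho>\<close> exceeds the diameter of the touching
    ball.\<close>
  define K where "K = sphere x1 \<rho> \<inter> cball y (norm \<xi>)"
  have "\<exists>\<epsilon>>0. \<forall>z\<in>K. w z \<ge> m + 2 * \<epsilon>"
  proof (cases "K = {}")
    case False
    have "compact K" by (auto simp: K_def intro: compact_Int_closed)
    from continuous_attains_inf[OF this False wcont] obtain z0 where z0: "z0 \<in> K" "\<And>z. z \<in> K \<Longrightarrow> w z0 \<le> w z"
      by blast
    have "w z0 > m" using z0(1) \<open>\<rho> > 0\<close> by (intro touch) (auto simp: K_def dist_commute)
    then show ?thesis using z0(2) by (intro exI[of _ "(w z0 - m) / 2"]) (auto simp: field_simps)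
  qed (auto intro: exI[of _ 1])
  then obtain \<epsilon> where "\<epsilon> > 0" and \<epsilon>: "\<And>z. z \<in> K \<Longrightarrow> w z \<ge> m + 2 * \<epsilon>" by blast
  define f where "f = (\<lambda>z. w z + (- \<epsilon>) * h z)"
  have fC2: "C2_with f (\<lambda>i z. w1 i z + (- \<epsilon>) * h1 i z) (\<lambda>i j z. w2 i j z + (- \<epsilon>) * h2 i j z)"
    unfolding f_def by (rule C2_with_add_scaled[OF C2 hC2])
  obtain p where p: "p \<in> cball x1 \<rho>" "\<And>z. z \<in> cball x1 \<rho> \<Longrightarrow> f p \<le> f z"
    using continuous_attains_inf[OF compact_cball _ C2_with_continuous[OF fC2], of x1 \<rho>] \<open>\<rho> > 0\<close> by auto
  \<comment> \<open>On \<open>K\<close> the gap \<open>2 * \<epsilon>\<close> beats the barrier,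
    which is at most one; off \<open>K\<close> the barrier is smaller than at
    \<open>x1\<close>.\<close>
  have "f z > f x1" if "z \<in> sphere x1 \<rho>" for z
  proof (cases "z \<in> K")
    case True
    have "h z \<le> 1" "h x1 > 0" using \<open>\<alpha> > 0\<close> by (auto simp: h_def)
    then have "\<epsilon> * h z \<le> \<epsilon> * 1" "\<epsilon> * h x1 > 0" using \<open>\<epsilon> > 0\<close> by (auto intro: mult_left_mono)
    moreover have "w x1 = m" using x1 by (simp add: Z_def)
    ultimately have "w x1 - \<epsilon> * h x1 < w z - \<epsilon> * h z" using \<epsilon>[OF True] \<open>\<epsilon> > 0\<close> by linarith
    then show ?thesis by (simp add: f_def)
  next
    case False
    then have "norm \<xi> < norm (z - y)" using that by (simp add: K_def dist_norm norm_minus_commute)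
    then have "(norm \<xi>)\<^sup>2 < (norm (z - y))\<^sup>2" by (intro power_strict_mono) auto
    then have "h z < h x1" using \<open>\<alpha> > 0\<close> by (simp add: h_def \<xi>_def power2_norm_eq_inner)
    moreover have "w x1 \<le> w z" using x1 min[of z] by (simp add: Z_def m_def)
    ultimately have "w x1 - \<epsilon> * h x1 < w z - \<epsilon> * h z"
      using mult_strict_left_mono[of "h z" "h x1" \<epsilon>] \<open>\<epsilon> > 0\<close> by linarith
    then show ?thesis by (simp add: f_def)
  qed
  moreover have "f p \<le> f x1" using p(2)[of x1] \<open>\<rho> > 0\<close> by simp
  ultimately have "p \<notin> sphere x1 \<rho>" by fastforce
  then have "dist p x1 < \<rho>" using p(1) by (auto simp: dist_commute)
  have "L (\<lambda>i z. w1 i z + (- \<epsilon>) * h1 i z) (\<lambda>i j z. w2 i j z + (- \<epsilon>) * h2 i j z) p \<ge> 0"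
  proof (rule L_nonneg_at_local_min[OF fC2])
    show "\<rho> - dist p x1 > 0" using \<open>dist p x1 < \<rho>\<close> by simp
    fix z assume "dist z p < \<rho> - dist p x1"
    then show "f p \<le> f z" using dist_triangle[of z x1 p] by (intro p(2)) (simp add: dist_commute)
  qed
  moreover have "\<epsilon> * L h1 h2 p > 0" using \<rho>[of p] \<open>dist p x1 < \<rho>\<close> \<open>\<epsilon> > 0\<close> by simp
  ultimately show False using super[of p] unfolding L_add_scaled by simp
qed

text \<open>A value below the minimum over the ball would let the perturbed function
  \<open>f\<close> attain a local minimum strictly outside the ball, where \<open>L\<close> of it is
  negative.\<close>

lemma confining_supersolution_attains_min:
  assumes C2: "C2_with w w1 w2" and super: "\<And>x. L w1 w2 x \<le> 0" and pos: "\<And>x. w x \<ge> 0"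
    and b: "\<And>i x. b i x = - (1/2) * x $ i" and trace: "\<And>i x. F i x \<bullet> F i x \<le> 1"
  obtains x0 where "\<And>x. w x0 \<le> w x"
proof -
  define N where "N = 2 * real CARD('n)"
  have wcont: "continuous_on S w" for S using C2_with_continuous[OF C2] .
  have "N > 0" by (simp add: N_def)
  obtain x0 where x0: "x0 \<in> cball 0 (sqrt N)" "\<And>z. z \<in> cball 0 (sqrt N) \<Longrightarrow> w x0 \<le> w z"
    using continuous_attains_inf[OF compact_cball _ wcont, of 0 "sqrt N"] \<open>N > 0\<close> by auto
  have inner: "w x0 \<le> w z" if "z \<bullet> z \<le> N" for z
    using x0(2)[of z] that by (simp add: norm_eq_sqrt_inner)
  have "w x0 \<le> w x" for x
  proof (rule ccontr)
    assume "\<not> w x0 \<le> w x"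
    then have x: "w x < w x0" "x \<bullet> x > N" using inner[of x] not_le by blast+
    \<comment> \<open>The penalty gained between the sphere and \<open>x\<close> uses up half of the
      gap, so \<open>f x\<close> stays below \<open>w x0 + \<epsilon> * N\<close>, a lower bound for
      \<open>f\<close> on the inner sphere.\<close>
    define \<epsilon> where "\<epsilon> = (w x0 - w x) / 2 / (x \<bullet> x - N)"
    have "\<epsilon> > 0" using x by (simp add: \<epsilon>_def)
    have "\<epsilon> * (x \<bullet> x - N) = (w x0 - w x) / 2" unfolding \<epsilon>_def by (rule nonzero_eq_divide_eq[THEN iffD1]) (use x in auto)
    define f where "f = (\<lambda>z. w z + \<epsilon> * (z \<bullet> z))"
    have fC2: "C2_with f (\<lambda>i z. w1 i z + \<epsilon> * (2 * z $ i)) (\<lambda>i j z. w2 i j z + \<epsilon> * (if i = j then 2 else 0))"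
      unfolding f_def by (rule C2_with_add_scaled[OF C2 C2_with_norm_sq])
    have fx: "f x < w x0 + \<epsilon> * N"
      using \<open>\<epsilon> * (x \<bullet> x - N) = _\<close> x by (simp add: f_def algebra_simps)
    \<comment> \<open>Beyond the second radius the penalty alone reaches
      \<open>w x0 + \<epsilon> * N\<close>, because \<open>w\<close> is nonnegative; the first
      radius keeps \<open>x\<close> in the region.\<close>
    define R where "R = max (norm x) (sqrt (N + w x0 / \<epsilon>))"
    define A where "A = cball (0::real^'n) R \<inter> {z. N \<le> z \<bullet> z}"
    have "compact A"
      unfolding A_def by (intro compact_Int_closed compact_cball closed_Collect_le continuous_intros)
    moreover have "x \<in> A" using x by (simp add: A_def R_def)
    ultimately obtain p where p: "p \<in> A" "\<And>z. z \<in> A \<Longrightarrow> f p \<le> f z"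
      using continuous_attains_inf[OF _ _ C2_with_continuous[OF fC2], of A] by blast
    have "f p < w x0 + \<epsilon> * N"
      using p(2)[OF \<open>x \<in> A\<close>] fx by simp
    have "norm p < R"
    proof (rule ccontr)
      assume "\<not> norm p < R"
      then have "(sqrt (N + w x0 / \<epsilon>))\<^sup>2 \<le> (norm p)\<^sup>2"
        using \<open>\<epsilon> > 0\<close> \<open>N > 0\<close> pos[of x0] by (intro power_mono) (auto simp: R_def)
      then have "N + w x0 / \<epsilon> \<le> p \<bullet> p"
        using \<open>\<epsilon> > 0\<close> \<open>N > 0\<close> pos[of x0] by (simp add: power2_norm_eq_inner)
      then have "\<epsilon> * (N + w x0 / \<epsilon>) \<le> \<epsilon> * (p \<bullet> p)" using \<open>\<epsilon> > 0\<close> by simp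
      then have "w x0 + \<epsilon> * N \<le> f p" using \<open>\<epsilon> > 0\<close> pos[of p] by (simp add: f_def algebra_simps)
      then show False using \<open>f p < _\<close> by simp
    qed
    have "p \<bullet> p > N"
    proof (rule ccontr)
      assume "\<not> p \<bullet> p > N"
      then have "p \<bullet> p = N" using p(1) by (simp add: A_def)
      then show False using inner[of p] \<open>f p < _\<close> by (simp add: f_def)
    qed
    have "open (ball 0 R \<inter> {z. N < z \<bullet> z})"
      by (intro open_Int open_Collect_less continuous_intros) auto
    moreover have "p \<in> ball 0 R \<inter> {z. N < z \<bullet> z}"
      using \<open>norm p < R\<close> \<open>p \<bullet> p > N\<close> by simp
    ultimately obtain \<delta> where "\<delta> > 0" and \<delta>: "ball p \<delta> \<subseteq> ball 0 R \<inter> {z. N < z \<bullet> z}"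
      unfolding open_contains_ball by blast
    have "f p \<le> f z" if "dist z p < \<delta>" for z
      using \<delta> that by (intro p(2)) (force simp: A_def dist_commute)
    then have "L (\<lambda>i z. w1 i z + \<epsilon> * (2 * z $ i)) (\<lambda>i j z. w2 i j z + \<epsilon> * (if i = j then 2 else 0)) p \<ge> 0"
      by (rule L_nonneg_at_local_min[OF fC2 \<open>\<delta> > 0\<close>])
    moreover have "L (\<lambda>i z. 2 * z $ i) (\<lambda>i j z. if i = j then 2 else 0) p < 0"
    proof -
      have "L (\<lambda>i z. 2 * z $ i) (\<lambda>i j z. if i = j then 2 else 0) p
          = 2 * (\<Sum>i\<in>UNIV. F i p \<bullet> F i p) - p \<bullet> p"
        by (simp add: L_def b if_distrib sum_distrib_left inner_vec_def sum_negf mult.commute cong: if_cong)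
      also have "(\<Sum>i\<in>UNIV. F i p \<bullet> F i p) \<le> (\<Sum>i\<in>(UNIV::'n set). 1)"
        by (intro sum_mono trace)
      finally show ?thesis using \<open>p \<bullet> p > N\<close> by (simp add: N_def)
    qed
    then have "\<epsilon> * L (\<lambda>i z. 2 * z $ i) (\<lambda>i j z. if i = j then 2 else 0) p < 0"
      using \<open>\<epsilon> > 0\<close> by (simp add: mult_pos_neg)
    ultimately show False using super[of p] unfolding L_add_scaled by simp
  qed
  then show thesis using that by blast
qed

end

section \<open>Derivatives of determinants and inverse matrices\<close>

lemma has_pd_det:
  fixes A :: "real^'n::finite \<Rightarrow> real^'k^'k::finite"
  assumes "\<And>i j. has_pd l (\<lambda>x. A x $ i $ j) (A' i j) x"
  shows "has_pd l (\<lambda>x. det (A x)) (\<Sum>i\<in>UNIV. det (\<chi> r c. if r = i then A' r c else A x $ r $ c)) x"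
proof -
  let ?P = "{p. p permutes (UNIV :: 'k set)}"
  have prod: "has_pd l (\<lambda>x. \<Prod>i\<in>UNIV. A x $ i $ p i) (\<Sum>i\<in>UNIV. A' i (p i) * (\<Prod>j\<in>UNIV - {i}. A x $ j $ p j)) x" for p
    using has_field_derivative_prod[of UNIV "\<lambda>i t. A (x + t *\<^sub>R axis l 1) $ i $ p i" "\<lambda>i. A' i (p i)" 0] assms
    by (simp add: has_pd_real)
  have "has_pd l (\<lambda>x. \<Sum>p\<in>?P. of_int (sign p) * (\<Prod>i\<in>UNIV. A x $ i $ p i))
     (\<Sum>p\<in>?P. of_int (sign p) * (\<Sum>i\<in>UNIV. A' i (p i) * (\<Prod>j\<in>UNIV - {i}. A x $ j $ p j))) x"
    by (intro has_pd_sum has_pd_bounded_linear[OF bounded_linear_mult_right] prod)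
  moreover have "(\<Sum>p\<in>?P. of_int (sign p) * (\<Sum>i\<in>UNIV. A' i (p i) * (\<Prod>j\<in>UNIV - {i}. A x $ j $ p j)))
     = (\<Sum>i\<in>UNIV. det (\<chi> r c. if r = i then A' r c else A x $ r $ c))"
  proof -
    have "A' i (p i) * (\<Prod>j\<in>UNIV - {i}. A x $ j $ p j) = (\<Prod>j\<in>UNIV. if j = i then A' j (p j) else A x $ j $ p j)"
      for i p
      by (subst prod.remove[of UNIV i]) (auto intro!: prod.cong)
    then have "(\<Sum>p\<in>?P. of_int (sign p) * (\<Sum>i\<in>UNIV. A' i (p i) * (\<Prod>j\<in>UNIV - {i}. A x $ j $ p j)))
      = (\<Sum>p\<in>?P. \<Sum>i\<in>UNIV. of_int (sign p) * (\<Prod>j\<in>UNIV. if j = i then A' j (p j) else A x $ j $ p j))"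
      by (simp add: sum_distrib_left)
    also have "\<dots> = (\<Sum>i\<in>UNIV. \<Sum>p\<in>?P. of_int (sign p) * (\<Prod>j\<in>UNIV. if j = i then A' j (p j) else A x $ j $ p j))"
      by (rule sum.swap)
    finally show ?thesis by (simp add: det_def)
  qed
  ultimately show ?thesis by (simp add: det_def)
qed

lemma continuous_on_det:
  fixes A :: "'a::topological_space \<Rightarrow> real^'k^'k::finite"
  assumes "\<And>i j. continuous_on S (\<lambda>x. A x $ i $ j)"
  shows "continuous_on S (\<lambda>x. det (A x))"
  unfolding det_def by (intro continuous_intros assms)

lemma matrix_inv_inverse:
  fixes A :: "real^'k^'k::finite"
  assumes "det A \<noteq> 0"
  shows "A ** matrix_inv A = mat 1" "matrix_inv A ** A = mat 1"
proof -
  have "\<exists>B. A ** B = mat 1 \<and> B ** A = mat 1"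
    using assms invertible_det_nz invertible_def by blast
  then have "A ** matrix_inv A = mat 1 \<and> matrix_inv A ** A = mat 1"
    unfolding matrix_inv_def by (rule someI_ex)
  then show "A ** matrix_inv A = mat 1" "matrix_inv A ** A = mat 1" by auto
qed

text \<open>Quotients of determinants make the differentiability and continuity of the entries of
  the inverse accessible.\<close>

lemma matrix_inv_cramer:
  fixes A :: "real^'k^'k::finite"
  assumes "det A \<noteq> 0"
  shows "matrix_inv A $ k $ l = det (\<chi> i j. if j = k then (if i = l then 1 else 0) else A $ i $ j) / det A"
proof -
  have "A *v (matrix_inv A *v axis l 1) = axis l 1"
    by (simp add: matrix_vector_mul_assoc matrix_inv_inverse[OF assms])
  then have "matrix_inv A *v axis l 1 = (\<chi> k. det (\<chi> i j. if j = k then axis l 1 $ i else A $ i $ j) / det A)"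
    using cramer[OF assms] by blast
  moreover have "(matrix_inv A *v axis l 1) $ k = matrix_inv A $ k $ l"
    by (simp add: matrix_vector_mult_basis column_def)
  ultimately have "matrix_inv A $ k $ l = det (\<chi> i j. if j = k then axis l 1 $ i else A $ i $ j) / det A"
    by simp
  then show ?thesis unfolding axis_def by (simp cong: if_cong)
qed

text \<open>Jacobi's formula. The derivative of row \<open>i\<close> is a combination of the rows of
  \<open>A x\<close> with coefficients \<open>y\<close>; once it replaces row \<open>i\<close> in
  the determinant, only the multiple of row \<open>i\<close> itself survives.\<close>

lemma has_pd_det_inverse:
  fixes A :: "real^'n::finite \<Rightarrow> real^'k^'k::finite"
  assumes A: "\<And>i j. has_pd l (\<lambda>x. A x $ i $ j) (A' i j) x" and nz: "det (A x) \<noteq> 0"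
  shows "has_pd l (\<lambda>x. det (A x)) (det (A x) * (\<Sum>i\<in>UNIV. \<Sum>j\<in>UNIV. matrix_inv (A x) $ j $ i * A' i j)) x"
proof -
  let ?G = "matrix_inv (A x)"
  have "det (\<chi> r c. if r = i then A' r c else A x $ r $ c) = (\<Sum>j\<in>UNIV. ?G $ j $ i * A' i j) * det (A x)" for i
  proof -
    define y where "y = (\<chi> j. A' i j) v* ?G"
    have "y v* A x = (\<chi> j. A' i j)"
      by (simp add: y_def vector_matrix_mul_assoc matrix_inv_inverse[OF nz])
    then have rows: "(\<Sum>r\<in>UNIV. y $ r *s row r (A x)) = (\<chi> j. A' i j)"
      by (simp add: vec_eq_iff vector_matrix_mult_def row_def mult.commute)
    have "det (\<chi> r. if r = i then (\<chi> j. A' i j) else row r (A x)) = y $ i * det (A x)"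
      by (rule cramer_lemma_transpose[of i y "A x", unfolded rows])
    moreover have "(\<chi> r. if r = i then (\<chi> j. A' i j) else row r (A x)) = (\<chi> r c. if r = i then A' r c else A x $ r $ c)"
      by (simp add: vec_eq_iff row_def)
    moreover have "y $ i = (\<Sum>j\<in>UNIV. ?G $ j $ i * A' i j)"
      by (simp add: y_def vector_matrix_mult_def mult.commute)
    ultimately show ?thesis by simp
  qed
  then show ?thesis
    using has_pd_det[OF A] by (simp add: sum_distrib_left mult.commute)
qed

text \<open>Existence of the derivative comes from Cramer's rule, its value from differentiating
  \<open>A ** matrix_inv A = mat 1\<close>.\<close>

lemma has_pd_matrix_inv:
  fixes A :: "real^'n::finite \<Rightarrow> real^'k^'k::finite"
  assumes A: "\<And>i j. has_pd l (\<lambda>x. A x $ i $ j) (A' i j) x" and nz: "\<And>x. det (A x) \<noteq> 0"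
  shows "has_pd l (\<lambda>x. matrix_inv (A x) $ i $ j)
     (- (\<Sum>a\<in>UNIV. \<Sum>b\<in>UNIV. matrix_inv (A x) $ i $ a * A' a b * matrix_inv (A x) $ b $ j)) x"
proof -
  let ?G = "\<lambda>x. matrix_inv (A x)"
  have "\<exists>D. has_pd l (\<lambda>x. ?G x $ i $ j) D x" for i j
  proof -
    have "\<exists>D. has_pd l (\<lambda>x. det (\<chi> r c. if c = i then (if r = j then 1 else 0) else A x $ r $ c)) D x"
    proof (rule exI, rule has_pd_det)
      show "has_pd l (\<lambda>x. (\<chi> r c. if c = i then (if r = j then 1 else 0) else A x $ r $ c) $ a $ b)
         (if b = i then 0 else A' a b) x" for a b
        using A by (cases "b = i") (auto intro: has_pd_const)
    qed
    then obtain D1 where D1: "has_pd l (\<lambda>x. det (\<chi> r c. if c = i then (if r = j then 1 else 0) else A x $ r $ c)) D1 x" ..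
    have D2: "has_pd l (\<lambda>x. inverse (det (A x))) (- (inverse (det (A x)) ^ Suc (Suc 0)) * (det (A x) * (\<Sum>i\<in>UNIV. \<Sum>j\<in>UNIV. ?G x $ j $ i * A' i j))) x"
      by (rule has_pd_chain[OF has_pd_det_inverse[OF A nz] DERIV_inverse[OF nz]])
    show ?thesis
      unfolding matrix_inv_cramer[OF nz] divide_inverse
      using has_pd_mult[OF D1 D2] by blast
  qed
  then obtain D where D: "\<And>i j. has_pd l (\<lambda>x. ?G x $ i $ j) (D i j) x" by metis
  have GA: "(\<Sum>a\<in>UNIV. ?G x $ i $ a * A x $ a $ b) = (if i = b then 1 else 0)" for i b
    using arg_cong[OF matrix_inv_inverse(2)[OF nz[of x]], of "\<lambda>M. M $ i $ b"]
    by (simp add: matrix_matrix_mult_def mat_def)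
  have key: "(\<Sum>b\<in>UNIV. A x $ a $ b * D b j + A' a b * ?G x $ b $ j) = 0" for a j
  proof -
    have "(\<Sum>b\<in>UNIV. A y $ a $ b * ?G y $ b $ j) = (if a = j then 1 else 0)" for y
      using arg_cong[OF matrix_inv_inverse(1)[OF nz[of y]], of "\<lambda>M. M $ a $ j"]
      by (simp add: matrix_matrix_mult_def mat_def)
    then have "has_pd l (\<lambda>x. \<Sum>b\<in>UNIV. A x $ a $ b * ?G x $ b $ j) 0 x"
      by (simp add: has_pd_const)
    moreover have "has_pd l (\<lambda>x. \<Sum>b\<in>UNIV. A x $ a $ b * ?G x $ b $ j)
      (\<Sum>b\<in>UNIV. A x $ a $ b * D b j + A' a b * ?G x $ b $ j) x"
      by (intro has_pd_sum has_pd_mult A D)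
    ultimately show ?thesis by (rule has_pd_unique[symmetric])
  qed
  have "D i j = (\<Sum>b\<in>UNIV. (\<Sum>a\<in>UNIV. ?G x $ i $ a * A x $ a $ b) * D b j)"
    by (simp add: GA if_distrib if_distribR cong: if_cong)
  also have "\<dots> = (\<Sum>a\<in>UNIV. ?G x $ i $ a * (\<Sum>b\<in>UNIV. A x $ a $ b * D b j))"
    unfolding sum_distrib_left sum_distrib_right by (subst sum.swap) (simp add: mult.assoc)
  also have "\<dots> = (\<Sum>a\<in>UNIV. ?G x $ i $ a * (- (\<Sum>b\<in>UNIV. A' a b * ?G x $ b $ j)))"
    using key by (simp add: sum.distrib add_eq_0_iff2)
  also have "\<dots> = - (\<Sum>a\<in>UNIV. \<Sum>b\<in>UNIV. ?G x $ i $ a * A' a b * ?G x $ b $ j)"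
    by (simp add: sum_distrib_left sum_negf mult.assoc)
  finally show ?thesis using D[of i j] by simp
qed

lemma continuous_on_matrix_inv:
  fixes A :: "'a::topological_space \<Rightarrow> real^'k^'k::finite"
  assumes "\<And>i j. continuous_on S (\<lambda>x. A x $ i $ j)" and nz: "\<And>x. det (A x) \<noteq> 0"
  shows "continuous_on S (\<lambda>x. matrix_inv (A x) $ i $ j)"
  unfolding matrix_inv_cramer[OF nz]
proof (intro continuous_on_divide continuous_on_det)
  show "continuous_on S (\<lambda>x. (\<chi> r c. if c = i then (if r = j then 1 else 0) else A x $ r $ c) $ a $ b)" for a b
    using assms(1) by (cases "b = i") auto
qed (use assms in auto)

section \<open>Geometry of a smooth graph\<close>

locale smooth_graph =
  fixes u :: "real^'n::finite \<Rightarrow> real^'m::finite"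
  assumes smooth: "smooth_map u"
begin

definition u1 :: "'n \<Rightarrow> real^'n \<Rightarrow> real^'m" where "u1 k = pds [k] u"
definition u2 :: "'n \<Rightarrow> 'n \<Rightarrow> real^'n \<Rightarrow> real^'m" where "u2 k l = pds [k, l] u"
definition u3 :: "'n \<Rightarrow> 'n \<Rightarrow> 'n \<Rightarrow> real^'n \<Rightarrow> real^'m" where "u3 i k l = pds [i, k, l] u"

definition X :: "'n \<Rightarrow> real^'n \<Rightarrow> (real^'n) \<times> (real^'m)" where "X k x = (axis k 1, u1 k x)"

definition G :: "'n \<Rightarrow> 'n \<Rightarrow> real^'n \<Rightarrow> real" where "G i j x = matrix_inv (gmat u x) $ i $ j"

text \<open>The basis dual to \<open>X\<close>. Its Gram matrix is \<open>G\<close>, so expanding the dual vectors in the standard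
  basis of the ambient space turns every contraction with \<open>G\<close> into a plain sum of products.\<close>

definition dual :: "'n \<Rightarrow> real^'n \<Rightarrow> (real^'n) \<times> (real^'m)" where
  "dual i x = (\<Sum>c\<in>UNIV. G i c x *\<^sub>R X c x)"

lemma has_pd_u: "has_pd k u (u1 k x) x"
  using smooth_has_pd[OF smooth, of k "[]" x] by (simp add: u1_def)

lemma has_pd_u1: "has_pd l (u1 k) (u2 l k x) x"
  unfolding u1_def u2_def by (rule smooth_has_pd[OF smooth])

lemma has_pd_u2: "has_pd i (u2 k l) (u3 i k l x) x"
  unfolding u2_def u3_def by (rule smooth_has_pd[OF smooth])

lemma u_continuous:
  "continuous_on S (u1 k)" "continuous_on S (u2 k l)" "continuous_on S (u3 i k l)"
  unfolding u1_def u2_def u3_def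
  by (rule continuous_on_subset[OF smooth_continuous[OF smooth]], simp)+

lemma u2_commute: "u2 k l x = u2 l k x"
  unfolding u2_def by (rule smooth_mixed_partials_commute[OF smooth])

text \<open>The general lemma exchanges the two outermost derivatives; the inner pair is exchanged
  by differentiating the equality of the functions \<open>u2 k l\<close> and
  \<open>u2 l k\<close>.\<close>

lemma u3_commute: "u3 i k l x = u3 k i l x" "u3 i k l x = u3 i l k x"
proof -
  show "u3 i k l x = u3 k i l x"
    unfolding u3_def by (rule smooth_mixed_partials_commute[OF smooth])
  have "u2 k l = u2 l k" by (auto simp: u2_commute)
  then show "u3 i k l x = u3 i l k x"
    using has_pd_u2[of i k l x] has_pd_u2[of i l k x] has_pd_unique by metis
qed

lemma pd_graph: "pd i (graph_map u) = X i"
proof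
  fix x
  have "has_pd i (\<lambda>x. (x, u x)) (X i x) x"
    unfolding X_def by (intro has_pd_Pair has_pd_id has_pd_u)
  then show "pd i (graph_map u) x = X i x"
    unfolding graph_map_def by (rule pd_eqI)
qed

lemma has_pd_X: "has_pd l (X k) (0, u2 l k x) x"
  unfolding X_def by (intro has_pd_Pair has_pd_const has_pd_u1)

lemma X_inner: "X i x \<bullet> X j x = (if i = j then 1 else 0) + u1 i x \<bullet> u1 j x"
  by (auto simp: X_def inner_axis_axis)

lemma gmat_entry: "gmat u x $ i $ j = X i x \<bullet> X j x"
  by (simp add: gmat_def pd_graph)

lemma fst_sum_X: "fst (\<Sum>i\<in>UNIV. c i *\<^sub>R X i x) $ k = c k"
proof -
  have "fst (\<Sum>i\<in>UNIV. c i *\<^sub>R X i x) $ k = (\<Sum>i\<in>UNIV. if k = i then c i else 0)"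
    unfolding fst_sum sum_component by (intro sum.cong) (auto simp: X_def axis_def)
  then show ?thesis by simp
qed

text \<open>A kernel vector \<open>z\<close> yields a tangent vector of length zero whose horizontal
  part is \<open>z\<close> itself.\<close>

lemma det_gmat_nonzero: "det (gmat u x) \<noteq> 0"
proof -
  have "z = 0" if "gmat u x *v z = 0" for z
  proof -
    let ?v = "\<Sum>i\<in>UNIV. z $ i *\<^sub>R X i x"
    have "?v \<bullet> ?v = (\<Sum>i\<in>UNIV. z $ i * (\<Sum>j\<in>UNIV. gmat u x $ i $ j * z $ j))"
      by (simp add: inner_sum_left inner_sum_right gmat_entry sum_distrib_left mult_ac inner_commute)
    also have "\<dots> = (\<Sum>i\<in>UNIV. z $ i * (gmat u x *v z) $ i)"
      by (simp add: matrix_vector_mult_def)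
    finally have "?v = 0" using that by simp
    then have "z $ k = 0" for k using fst_sum_X[of "\<lambda>i. z $ i" x k] by simp
    then show "z = 0" by (simp add: vec_eq_iff)
  qed
  then have "\<exists>B. B ** gmat u x = mat 1" by (simp add: matrix_left_invertible_ker)
  then show ?thesis using invertible_det_nz invertible_left_inverse by blast
qed

lemma dual_inner_X: "dual i x \<bullet> X j x = (if i = j then 1 else 0)"
proof -
  have "dual i x \<bullet> X j x = (matrix_inv (gmat u x) ** gmat u x) $ i $ j"
    by (simp add: dual_def G_def inner_sum_left matrix_matrix_mult_def gmat_entry)
  then show ?thesis
    by (simp add: matrix_inv_inverse[OF det_gmat_nonzero] mat_def)
qed

lemma G_commute: "G i j x = G j i x"
proof -
  have "dual i x \<bullet> dual j x = G j i x" for i j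
    by (simp add: dual_def[of j] inner_sum_right dual_inner_X if_distrib cong: if_cong)
  then show ?thesis by (metis inner_commute)
qed

lemma dual_inner_dual: "dual i x \<bullet> dual j x = G i j x"
  by (simp add: dual_def[of j] inner_sum_right dual_inner_X if_distrib G_commute[of i j] cong: if_cong)

lemma fst_dual: "fst (dual i x) $ k = G i k x"
  unfolding dual_def by (rule fst_sum_X)

text \<open>\<open>G i i x\<close> is both a coordinate of \<open>dual i x\<close> and its squared
  norm, hence dominates its own square. This bounds the trace of the operator by the
  dimension.\<close>

lemma G_diag_le_1: "G i i x \<le> 1"
proof -
  have "(G i i x)\<^sup>2 = (fst (dual i x) $ i)\<^sup>2" by (simp add: fst_dual)
  also have "\<dots> \<le> (norm (dual i x))\<^sup>2"
  proof (rule power2_le_iff_abs_le[THEN iffD2])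
    have "\<bar>fst (dual i x) $ i\<bar> \<le> norm (fst (dual i x))" by (rule component_le_norm_cart)
    also have "\<dots> \<le> norm (dual i x)" by (metis norm_fst_le prod.collapse)
    finally show "\<bar>fst (dual i x) $ i\<bar> \<le> norm (dual i x)" .
  qed simp
  also have "\<dots> = G i i x" by (simp add: power2_norm_eq_inner dual_inner_dual)
  finally show ?thesis by (cases "G i i x \<le> 0") (auto simp: power2_eq_square mult_le_cancel_left1)
qed

text \<open>This is the ellipticity that the strong minimum principle asks for.\<close>

lemma dual_independent: "(\<Sum>i\<in>UNIV. \<xi> $ i *\<^sub>R dual i x) = 0 \<Longrightarrow> \<xi> = 0"
proof -
  assume 0: "(\<Sum>i\<in>UNIV. \<xi> $ i *\<^sub>R dual i x) = 0"
  have "(\<Sum>i\<in>UNIV. \<xi> $ i *\<^sub>R dual i x) \<bullet> X k x = \<xi> $ k" for k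
    by (simp add: inner_sum_left dual_inner_X if_distrib cong: if_cong)
  then show "\<xi> = 0" using 0 by (simp add: vec_eq_iff)
qed

section \<open>The normal projection and a global normal frame\<close>

lemma nproj_eq: "nproj u x v = v - (\<Sum>k\<in>UNIV. (v \<bullet> dual k x) *\<^sub>R X k x)"
  unfolding nproj_def tspace_def pd_graph
proof (rule the_equality)
  let ?t = "\<Sum>k\<in>UNIV. (v \<bullet> dual k x) *\<^sub>R X k x"
  have t: "?t \<in> span (range (\<lambda>i. X i x))"
    by (intro span_sum span_mul span_base) auto
  have "?t \<bullet> X i x = v \<bullet> X i x" for i
  proof -
    have "?t \<bullet> X i x = (\<Sum>c\<in>UNIV. \<Sum>k\<in>UNIV. (v \<bullet> X c x) * (G c k x * (X k x \<bullet> X i x)))"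
      unfolding dual_def inner_sum_left inner_sum_right inner_scaleR_left inner_scaleR_right sum_distrib_right
      by (subst sum.swap) (simp add: mult_ac G_commute)
    also have "\<dots> = (\<Sum>c\<in>UNIV. (v \<bullet> X c x) * (dual c x \<bullet> X i x))"
      by (simp add: dual_def inner_sum_left sum_distrib_left)
    finally show ?thesis by (simp add: dual_inner_X if_distrib cong: if_cong)
  qed
  then have n: "\<forall>i. (v - ?t) \<bullet> X i x = 0" by (simp add: inner_diff_left)
  show "(\<forall>i. (v - ?t) \<bullet> X i x = 0) \<and> v - (v - ?t) \<in> span (range (\<lambda>i. X i x))"
    using n t by simp
  fix w assume w: "(\<forall>i. w \<bullet> X i x = 0) \<and> v - w \<in> span (range (\<lambda>i. X i x))"
  have "w - (v - ?t) \<in> span (range (\<lambda>i. X i x))"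
    using span_diff[OF t conjunct2[OF w]] by (simp add: algebra_simps)
  moreover have "orthogonal (w - (v - ?t)) y" if "y \<in> range (\<lambda>i. X i x)" for y
    using that w n by (auto simp: orthogonal_def inner_diff_left)
  ultimately have "orthogonal (w - (v - ?t)) (w - (v - ?t))"
    by (rule orthogonal_to_span)
  then show "w = v - ?t" by (simp add: orthogonal_self)
qed

text \<open>Testing against normal vectors removes the projection, so equations between normal
  vectors become equations for the derivatives of \<open>u\<close>.\<close>

lemma nproj_inner_normal:
  assumes "\<And>i. \<nu> \<bullet> X i x = 0"
  shows "nproj u x v \<bullet> \<nu> = v \<bullet> \<nu>"
proof -
  have "X i x \<bullet> \<nu> = 0" for i using assms[of i] by (simp add: inner_commute)
  then show ?thesis by (simp add: nproj_eq inner_diff_left inner_sum_left)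
qed

text \<open>A global normal frame with \<open>\<langle>X\<^sub>i\<^sub>j, nu a\<rangle> = u\<^sub>i\<^sub>j \<bullet> a\<close>.\<close>

definition nu :: "real^'m \<Rightarrow> real^'n \<Rightarrow> (real^'n) \<times> (real^'m)" where
  "nu a x = (- (\<Sum>k\<in>UNIV. (u1 k x \<bullet> a) *\<^sub>R axis k 1), a)"

lemma sum_axis_inner: "(\<Sum>k\<in>UNIV. c k *\<^sub>R axis k 1) \<bullet> (v :: real^'n) = (\<Sum>k\<in>UNIV. c k * v $ k)"
  by (simp add: inner_sum_left inner_axis')

lemma inner_nu: "(v, c) \<bullet> nu a x = c \<bullet> a - (\<Sum>k\<in>UNIV. v $ k * (u1 k x \<bullet> a))"
  by (simp add: nu_def inner_commute[of v] sum_axis_inner mult.commute)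

lemma nu_normal: "nu a x \<bullet> X i x = 0"
proof -
  have "(\<Sum>k\<in>UNIV. axis i 1 $ k * (u1 k x \<bullet> a)) = (\<Sum>k\<in>UNIV. if k = i then u1 k x \<bullet> a else 0)"
    by (intro sum.cong) (auto simp: axis_def)
  then show ?thesis
    by (simp add: inner_commute[of "nu a x"] X_def inner_nu)
qed

lemma X_inner_nu: "X i x \<bullet> nu a x = 0"
  using nu_normal by (simp add: inner_commute)

text \<open>A closed form for all iterated derivatives of \<open>nu a\<close>: new derivatives stand
  in front of the \<open>k\<close> already present in \<open>nu\<close>, and the constant second
  component survives only undifferentiated.\<close>

definition nu_pds :: "real^'m \<Rightarrow> 'n list \<Rightarrow> real^'n \<Rightarrow> (real^'n) \<times> (real^'m)" where
  "nu_pds a is x = (- (\<Sum>k\<in>UNIV. (pds (is @ [k]) u x \<bullet> a) *\<^sub>R axis k 1), if is = [] then a else 0)"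

lemma has_pd_nu_pds: "has_pd i (nu_pds a is) (nu_pds a (i # is) x) x"
proof -
  have "has_pd i (\<lambda>x. (pds (is @ [k]) u x \<bullet> a) *\<^sub>R axis k 1) ((pds (i # is @ [k]) u x \<bullet> a) *\<^sub>R (axis k 1 :: real^'n)) x" for k
    by (intro has_pd_bounded_linear[OF bounded_linear_scaleR_left]
        has_pd_bounded_linear[OF bounded_linear_inner_left] smooth_has_pd[OF smooth])
  then have "has_pd i (nu_pds a is) (- (\<Sum>k\<in>UNIV. (pds (i # is @ [k]) u x \<bullet> a) *\<^sub>R axis k 1), 0) x"
    unfolding nu_pds_def by (intro has_pd_Pair has_pd_const has_pd_minus has_pd_sum)
  then show ?thesis by (simp add: nu_pds_def)
qed

lemma pds_nu: "pds is (nu a) = nu_pds a is"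
proof (induction "is")
  case Nil
  show ?case by (simp add: fun_eq_iff nu_def nu_pds_def u1_def)
next
  case (Cons i "is")
  show ?case by (intro ext) (simp add: Cons.IH pd_eqI[OF has_pd_nu_pds])
qed

lemma smooth_nu: "smooth_map (nu a)"
  unfolding smooth_map_def pds_nu
proof (intro allI conjI)
  show "continuous_on UNIV (nu_pds a is)" for "is"
    unfolding nu_pds_def by (intro continuous_intros smooth_continuous[OF smooth])
  show "(\<lambda>t. nu_pds a is (x + t *\<^sub>R axis i 1)) differentiable at 0" for "is" i x
    using has_pd_nu_pds[of i a "is" x] by (auto simp: has_pd_def intro: differentiableI_vector)
qed

text \<open>Flatness is a statement about smooth normal fields, so the frame has to consist of such
  fields.\<close>

lemma normal_field_nu: "normal_field u (nu a)"
  by (simp add: normal_field_def smooth_nu pd_graph nu_normal)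

text \<open>Pairing with \<open>nu a x\<close> strips the projections; the position vector
  contributes \<open>u x \<bullet> a\<close> minus its radial derivative, and \<open>a\<close> is
  arbitrary.\<close>

lemma self_shrinker_equation:
  assumes "self_shrinker u"
  shows "(\<Sum>i\<in>UNIV. \<Sum>j\<in>UNIV. G i j x *\<^sub>R u2 i j x) = (1/2) *\<^sub>R ((\<Sum>k\<in>UNIV. x $ k *\<^sub>R u1 k x) - u x)"
proof -
  have "pd i (X j) x = (0, u2 i j x)" for i j
    by (rule pd_eqI[OF has_pd_X])
  moreover have "mean_curv u x = - (1/2) *\<^sub>R nproj u x (graph_map u x)"
    using assms by (simp add: self_shrinker_def)
  ultimately have H: "(\<Sum>i\<in>UNIV. \<Sum>j\<in>UNIV. G i j x *\<^sub>R nproj u x (0, u2 i j x)) = - (1/2) *\<^sub>R nproj u x (x, u x)"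
    by (simp add: mean_curv_def pd_graph G_def graph_map_def)
  have "(\<Sum>i\<in>UNIV. \<Sum>j\<in>UNIV. G i j x *\<^sub>R u2 i j x) \<bullet> a = ((1/2) *\<^sub>R ((\<Sum>k\<in>UNIV. x $ k *\<^sub>R u1 k x) - u x)) \<bullet> a" for a
    using arg_cong[OF H, of "\<lambda>v. v \<bullet> nu a x"]
    by (simp add: inner_sum_left nproj_inner_normal[OF nu_normal] inner_nu inner_diff_left) (simp add: field_simps)
  then show ?thesis by (rule vector_eq_rdot[THEN iffD1, OF allI])
qed

section \<open>Derivatives and continuity of the induced metric and its inverse\<close>

definition dg :: "'n \<Rightarrow> 'n \<Rightarrow> 'n \<Rightarrow> real^'n \<Rightarrow> real" where
  "dg l a b x = u1 a x \<bullet> u2 l b x + u2 l a x \<bullet> u1 b x"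

definition dG :: "'n \<Rightarrow> 'n \<Rightarrow> 'n \<Rightarrow> real^'n \<Rightarrow> real" where
  "dG l i j x = - (\<Sum>a\<in>UNIV. \<Sum>b\<in>UNIV. G i a x * dg l a b x * G b j x)"

lemma has_pd_gmat: "has_pd l (\<lambda>x. gmat u x $ i $ j) (dg l i j x) x"
proof -
  have "has_pd l (\<lambda>x. (if i = j then 1 else 0) + u1 i x \<bullet> u1 j x) (0 + dg l i j x) x"
    unfolding dg_def by (intro has_pd_add has_pd_const has_pd_inner has_pd_u1)
  then show ?thesis by (simp add: gmat_entry X_inner)
qed

lemma has_pd_G: "has_pd l (G i j) (dG l i j x) x"
  unfolding G_def dG_def by (rule has_pd_matrix_inv[OF has_pd_gmat det_gmat_nonzero])

lemma has_pd_dual: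
  "has_pd l (dual k) (\<Sum>c\<in>UNIV. G k c x *\<^sub>R (0, u2 l c x) + dG l k c x *\<^sub>R X c x) x"
  unfolding dual_def by (intro has_pd_sum has_pd_scaleR has_pd_G has_pd_X)

lemma gmat_continuous: "continuous_on S (\<lambda>x. gmat u x $ i $ j)"
  unfolding gmat_entry X_inner by (intro continuous_intros u_continuous)

lemma G_continuous: "continuous_on S (G i j)"
  unfolding G_def by (rule continuous_on_matrix_inv[OF gmat_continuous det_gmat_nonzero])

lemma dual_continuous: "continuous_on S (dual i)"
  unfolding dual_def X_def by (intro continuous_intros G_continuous u_continuous)

text \<open>The Ricci equation in coordinates. Paired with \<open>nu b\<close>, the second normal
  derivative of \<open>nu a\<close> is the full second derivative, symmetric in \<open>i\<close> and
  \<open>j\<close>, plus a product of two shape operators that comes from the tangential part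
  removed by the first projection.\<close>

lemma flat_normal_bundle_shape_operators_commute:
  assumes "flat_normal_bundle u"
  shows "(\<Sum>k\<in>UNIV. \<Sum>l\<in>UNIV. G k l x * (u2 i k x \<bullet> a) * (u2 j l x \<bullet> b)) =
         (\<Sum>k\<in>UNIV. \<Sum>l\<in>UNIV. G k l x * (u2 j k x \<bullet> a) * (u2 i l x \<bullet> b))"
proof -
  have curv: "nabla_perp u i (nabla_perp u j (nu a)) x \<bullet> nu b x =
      nu_pds a [i, j] x \<bullet> nu b x + (\<Sum>k\<in>UNIV. \<Sum>l\<in>UNIV. G k l x * (u2 j k x \<bullet> a) * (u2 i l x \<bullet> b))" for i j
  proof -
    let ?c = "\<lambda>k x. nu_pds a [j] x \<bullet> dual k x"
    have c: "?c k x = - (\<Sum>l\<in>UNIV. G k l x * (u2 j l x \<bullet> a))" for k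
    proof -
      have "nu_pds a [j] x \<bullet> X l x = - (u2 j l x \<bullet> a)" for l
      proof -
        have "nu_pds a [j] x \<bullet> X l x = - (\<Sum>k\<in>UNIV. (u2 j k x \<bullet> a) * (axis l 1 $ k))"
          by (simp add: nu_pds_def X_def u2_def sum_axis_inner)
        also have "(\<Sum>k\<in>UNIV. (u2 j k x \<bullet> a) * (axis l 1 $ k)) = (\<Sum>k\<in>UNIV. if k = l then u2 j k x \<bullet> a else 0)"
          by (intro sum.cong) (auto simp: axis_def)
        finally show ?thesis by simp
      qed
      then show ?thesis by (simp add: dual_def inner_sum_right sum_negf)
    qed
    have nab: "nabla_perp u j (nu a) = (\<lambda>x. nu_pds a [j] x - (\<Sum>k\<in>UNIV. ?c k x *\<^sub>R X k x))"
      using pds_nu[of "[j]" a] by (simp add: fun_eq_iff nabla_perp_def nproj_eq)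
    \<comment> \<open>Existence suffices: the derivative multiplies the tangent vector
      \<open>X k x\<close>, which \<open>nu b x\<close> annihilates.\<close>
    have "\<exists>d. has_pd i (?c k) d x" for k
      using has_pd_inner[OF has_pd_nu_pds has_pd_dual] by blast
    then obtain d where d: "\<And>k. has_pd i (?c k) (d k) x" by metis
    have "has_pd i (nabla_perp u j (nu a))
       (nu_pds a [i, j] x - (\<Sum>k\<in>UNIV. ?c k x *\<^sub>R (0, u2 i k x) + d k *\<^sub>R X k x)) x"
      unfolding nab by (intro has_pd_diff has_pd_sum has_pd_nu_pds has_pd_scaleR d has_pd_X)
    then have "nabla_perp u i (nabla_perp u j (nu a)) x \<bullet> nu b x
       = (nu_pds a [i, j] x - (\<Sum>k\<in>UNIV. ?c k x *\<^sub>R (0, u2 i k x) + d k *\<^sub>R X k x)) \<bullet> nu b x"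
      by (simp only: nabla_perp_def[of u i] pd_eqI nproj_inner_normal[OF nu_normal])
    also have "\<dots> = nu_pds a [i, j] x \<bullet> nu b x - (\<Sum>k\<in>UNIV. ?c k x * (u2 i k x \<bullet> b))"
      by (simp add: inner_diff_left inner_sum_left inner_add_left inner_nu X_inner_nu
          del: scaleR_Pair)
    also have "(\<Sum>k\<in>UNIV. ?c k x * (u2 i k x \<bullet> b)) =
        - (\<Sum>k\<in>UNIV. \<Sum>l\<in>UNIV. G k l x * (u2 j k x \<bullet> a) * (u2 i l x \<bullet> b))"
      unfolding c sum_distrib_right minus_mult_left[symmetric] sum_negf
      by (subst sum.swap) (simp add: G_commute)
    finally show ?thesis by simp
  qed
  have "nu_pds a [i, j] x = nu_pds a [j, i] x"
    using smooth_mixed_partials_commute[OF smooth_nu, of i j "[]" a x] by (simp only: pds_nu)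
  moreover have "nabla_perp u i (nabla_perp u j (nu a)) x = nabla_perp u j (nabla_perp u i (nu a)) x"
    using assms normal_field_nu unfolding flat_normal_bundle_def by blast
  ultimately show ?thesis using curv[of i j] curv[of j i] by simp
qed

end

section \<open>Contraction with the inverse metric\<close>

lemma sum_pull:
  fixes c :: "'i \<Rightarrow> 'j \<Rightarrow> real"
  shows "(\<Sum>i\<in>I. \<Sum>j\<in>J. c i j * (\<Sum>r\<in>R. y r i j)) = (\<Sum>r\<in>R. \<Sum>i\<in>I. \<Sum>j\<in>J. c i j * y r i j)"
proof -
  have "(\<Sum>i\<in>I. \<Sum>j\<in>J. c i j * (\<Sum>r\<in>R. y r i j)) = (\<Sum>i\<in>I. \<Sum>r\<in>R. \<Sum>j\<in>J. c i j * y r i j)"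
    unfolding sum_distrib_left by (intro sum.cong refl sum.swap)
  then show ?thesis by (simp add: sum.swap[of _ I])
qed

text \<open>Contraction with a Gram matrix acts like summation over an orthonormal frame, even when
  the index set \<open>B\<close> is larger than the dimension.\<close>

lemma gram_contract:
  fixes F :: "'n::finite \<Rightarrow> 's \<Rightarrow> real" and f h :: "'n \<Rightarrow> 'b::real_inner"
  assumes g: "\<And>i j. g i j = (\<Sum>s\<in>B. F i s * F j s)"
  shows "(\<Sum>i\<in>UNIV. \<Sum>j\<in>UNIV. g i j * (f i \<bullet> h j)) =
    (\<Sum>s\<in>B. (\<Sum>i\<in>UNIV. F i s *\<^sub>R f i) \<bullet> (\<Sum>j\<in>UNIV. F j s *\<^sub>R h j))"
proof -
  have "(\<Sum>s\<in>B. (\<Sum>i\<in>UNIV. F i s *\<^sub>R f i) \<bullet> (\<Sum>j\<in>UNIV. F j s *\<^sub>R h j))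
    = (\<Sum>s\<in>B. \<Sum>i\<in>UNIV. \<Sum>j\<in>UNIV. (f i \<bullet> h j) * (F i s * F j s))"
    unfolding inner_sum_left unfolding inner_sum_right by (simp add: mult_ac)
  also have "\<dots> = (\<Sum>i\<in>UNIV. \<Sum>j\<in>UNIV. (f i \<bullet> h j) * (\<Sum>s\<in>B. F i s * F j s))"
    by (rule sum_pull[symmetric])
  finally show ?thesis by (simp add: g mult.commute)
qed

lemma gram_contract_real:
  fixes F :: "'n::finite \<Rightarrow> 's \<Rightarrow> real" and f h :: "'n \<Rightarrow> real"
  assumes g: "\<And>i j. g i j = (\<Sum>s\<in>B. F i s * F j s)"
  shows "(\<Sum>i\<in>UNIV. \<Sum>j\<in>UNIV. g i j * (f i * h j)) =
    (\<Sum>s\<in>B. (\<Sum>i\<in>UNIV. F i s * f i) * (\<Sum>j\<in>UNIV. F j s * h j))"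
  using gram_contract[of g F B f h] g by simp

lemma gram_contract3:
  fixes F :: "'n::finite \<Rightarrow> 's \<Rightarrow> real" and f h :: "'n \<Rightarrow> 'n \<Rightarrow> 'n \<Rightarrow> real"
  assumes g: "\<And>i j. g i j = (\<Sum>s\<in>B. F i s * F j s)"
  defines "hat \<equiv> \<lambda>f s t r. \<Sum>i\<in>UNIV. F i s * (\<Sum>j\<in>UNIV. F j t * (\<Sum>k\<in>UNIV. F k r * f i j k))"
  shows "(\<Sum>i\<in>UNIV. \<Sum>i'\<in>UNIV. g i i' * (\<Sum>j\<in>UNIV. \<Sum>j'\<in>UNIV. g j j' *
            (\<Sum>k\<in>UNIV. \<Sum>k'\<in>UNIV. g k k' * (f i j k * h i' j' k')))) =
    (\<Sum>s\<in>B. \<Sum>t\<in>B. \<Sum>r\<in>B. hat f s t r * hat h s t r)"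
proof -
  have "(\<Sum>i\<in>UNIV. \<Sum>i'\<in>UNIV. g i i' * (\<Sum>j\<in>UNIV. \<Sum>j'\<in>UNIV. g j j' *
            (\<Sum>k\<in>UNIV. \<Sum>k'\<in>UNIV. g k k' * (f i j k * h i' j' k')))) =
     (\<Sum>r\<in>B. \<Sum>t\<in>B. \<Sum>s\<in>B. hat f s t r * hat h s t r)"
  proof -
    define A where "A = (\<lambda>(f :: 'n \<Rightarrow> 'n \<Rightarrow> 'n \<Rightarrow> real) i j r. \<Sum>k\<in>UNIV. F k r * f i j k)"
    define A2 where "A2 = (\<lambda>f i t r. \<Sum>j\<in>UNIV. F j t * A f i j r)"
    note c = gram_contract_real[of g F B, OF g]
    have hat: "hat f s t r = (\<Sum>i\<in>UNIV. F i s * A2 f i t r)" for f s t r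
      by (simp add: hat_def A_def A2_def)
    have 1: "(\<Sum>k\<in>UNIV. \<Sum>k'\<in>UNIV. g k k' * (f i j k * h i' j' k')) = (\<Sum>r\<in>B. A f i j r * A h i' j' r)"
      for i j i' j'
      unfolding A_def by (rule c)
    have 2: "(\<Sum>j\<in>UNIV. \<Sum>j'\<in>UNIV. g j j' * (\<Sum>r\<in>B. A f i j r * A h i' j' r)) =
        (\<Sum>r\<in>B. \<Sum>t\<in>B. A2 f i t r * A2 h i' t r)" for i i'
      by (rule trans[OF sum_pull]) (unfold A2_def, rule sum.cong[OF refl c])
    have 3: "(\<Sum>i\<in>UNIV. \<Sum>i'\<in>UNIV. g i i' * (\<Sum>r\<in>B. \<Sum>t\<in>B. A2 f i t r * A2 h i' t r)) =
        (\<Sum>r\<in>B. \<Sum>t\<in>B. \<Sum>s\<in>B. hat f s t r * hat h s t r)"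
      by (rule trans[OF sum_pull], rule sum.cong[OF refl], rule trans[OF sum_pull])
        (unfold hat, rule sum.cong[OF refl c])
    show ?thesis by (simp only: 1 2 3)
  qed
  also have "\<dots> = (\<Sum>r\<in>B. \<Sum>s\<in>B. \<Sum>t\<in>B. hat f s t r * hat h s t r)"
    by (intro sum.cong refl sum.swap)
  also have "\<dots> = (\<Sum>s\<in>B. \<Sum>r\<in>B. \<Sum>t\<in>B. hat f s t r * hat h s t r)"
    by (rule sum.swap)
  also have "\<dots> = (\<Sum>s\<in>B. \<Sum>t\<in>B. \<Sum>r\<in>B. hat f s t r * hat h s t r)"
    by (intro sum.cong refl sum.swap)
  finally show ?thesis .
qed

lemma sum_rotate3:
  "(\<Sum>s\<in>B. \<Sum>t\<in>B. \<Sum>r\<in>B. f s t r) = (\<Sum>s\<in>B. \<Sum>t\<in>B. \<Sum>r\<in>B. f t r s)"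
proof -
  have "(\<Sum>s\<in>B. \<Sum>t\<in>B. \<Sum>r\<in>B. f t r s) = (\<Sum>t\<in>B. \<Sum>s\<in>B. \<Sum>r\<in>B. f t r s)"
    by (rule sum.swap)
  also have "\<dots> = (\<Sum>t\<in>B. \<Sum>r\<in>B. \<Sum>s\<in>B. f t r s)"
    by (intro sum.cong refl sum.swap)
  finally show ?thesis ..
qed

text \<open>By symmetry in the first two arguments and renaming of indices, three of the four
  products in the expansion have equal total sums; two of them enter with a plus sign and one with a
  minus sign.\<close>

lemma trilinear_collapse:
  fixes T :: "'s \<Rightarrow> 's \<Rightarrow> 's \<Rightarrow> real"
  assumes sym: "\<And>s t r. T s t r = T t s r"
  shows "(\<Sum>s\<in>B. \<Sum>t\<in>B. \<Sum>r\<in>B. (T s r t + T s t r) * (T t r s - T s t r)) =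
    (\<Sum>s\<in>B. \<Sum>t\<in>B. \<Sum>r\<in>B. T s r t * T s t r) - (\<Sum>s\<in>B. \<Sum>t\<in>B. \<Sum>r\<in>B. T s t r * T s t r)"
proof -
  have "(T s r t + T s t r) * (T t r s - T s t r) =
      T r s t * T r t s + T t s r * T t r s - T s r t * T s t r - T s t r * T s t r" for s t r
    using sym[of s r t] sym[of t r s] sym[of s t r] by (simp add: algebra_simps)
  moreover have "(\<Sum>s\<in>B. \<Sum>t\<in>B. \<Sum>r\<in>B. T t s r * T t r s) = (\<Sum>s\<in>B. \<Sum>t\<in>B. \<Sum>r\<in>B. T s r t * T s t r)"
    by (subst (2) sum_rotate3) (rule refl)
  moreover have "(\<Sum>s\<in>B. \<Sum>t\<in>B. \<Sum>r\<in>B. T r s t * T r t s) = (\<Sum>s\<in>B. \<Sum>t\<in>B. \<Sum>r\<in>B. T s r t * T s t r)"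
    by (subst sum_rotate3) (simp add: mult.commute)
  ultimately show ?thesis by (simp add: sum.distrib sum_subtractf)
qed

section \<open>Derivatives of the graph in components of the ambient basis\<close>

context smooth_graph
begin

text \<open>By \<open>nproj_eq\<close> the numbers \<open>dual k x \<bullet> s\<close> are the
  coordinates of the tangential part of \<open>s\<close>, so \<open>P s x\<close> is the vertical
  component of that part.\<close>

definition P :: "(real^'n) \<times> (real^'m) \<Rightarrow> real^'n \<Rightarrow> real^'m" where
  "P s x = (\<Sum>k\<in>UNIV. (dual k x \<bullet> s) *\<^sub>R u1 k x)"

text \<open>The Hessian of \<open>u\<close> on the coordinate vectors of the tangential parts of
  \<open>s\<close> and \<open>t\<close>.\<close>

definition Q :: "(real^'n) \<times> (real^'m) \<Rightarrow> (real^'n) \<times> (real^'m) \<Rightarrow> real^'n \<Rightarrow> real^'m" where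
  "Q s t x = (\<Sum>k\<in>UNIV. (dual k x \<bullet> s) *\<^sub>R (\<Sum>l\<in>UNIV. (dual l x \<bullet> t) *\<^sub>R u2 k l x))"

text \<open>\<open>V\<close> is the gradient of half the logarithm of \<open>det g\<close>.\<close>

definition V :: "'n \<Rightarrow> real^'n \<Rightarrow> real" where
  "V k x = (\<Sum>i\<in>UNIV. \<Sum>j\<in>UNIV. G i j x * (u2 k i x \<bullet> u1 j x))"

definition dV :: "'n \<Rightarrow> 'n \<Rightarrow> real^'n \<Rightarrow> real" where
  "dV k l x = (\<Sum>i\<in>UNIV. \<Sum>j\<in>UNIV. G i j x * (u2 l i x \<bullet> u2 k j x + u3 k l i x \<bullet> u1 j x)
      + dG k i j x * (u2 l i x \<bullet> u1 j x))"

text \<open>The squared norm of the second fundamental form, see \<open>sff_sq_eq\<close>.\<close>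

definition sff_sq :: "real^'n \<Rightarrow> real" where
  "sff_sq x = (\<Sum>s\<in>Basis. \<Sum>t\<in>Basis. Q s t x \<bullet> Q s t x - (\<Sum>r\<in>Basis. (Q s t x \<bullet> P r x) * (Q s t x \<bullet> P r x)))"

lemma G_gram: "G i j x = (\<Sum>s\<in>Basis. (dual i x \<bullet> s) * (dual j x \<bullet> s))"
  by (subst dual_inner_dual[symmetric]) (rule euclidean_inner)

lemmas G_contract = gram_contract[where g = "\<lambda>i j. G i j x" and B = Basis and F = "\<lambda>i s. dual i x \<bullet> s" for x, OF G_gram]
lemmas G_contract_real = gram_contract_real[where g = "\<lambda>i j. G i j x" and B = Basis and F = "\<lambda>i s. dual i x \<bullet> s" for x, OF G_gram]
lemmas G_contract3 = gram_contract3[where g = "\<lambda>i j. G i j x" and B = Basis and F = "\<lambda>i s. dual i x \<bullet> s" for x, OF G_gram]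

lemma Q_commute: "Q s t x = Q t s x"
  unfolding Q_def scaleR_sum_right
  by (subst sum.swap) (simp add: u2_commute mult.commute)

lemma inner_P: "a \<bullet> P r x = (\<Sum>k\<in>UNIV. (dual k x \<bullet> r) * (a \<bullet> u1 k x))"
  by (simp add: P_def inner_sum_right)

lemma Q_inner: "Q s t x \<bullet> a = (\<Sum>k\<in>UNIV. (dual k x \<bullet> s) * (\<Sum>l\<in>UNIV. (dual l x \<bullet> t) * (u2 k l x \<bullet> a)))"
  by (simp add: Q_def inner_sum_left)

lemma hat_u2_u1:
  "(\<Sum>i\<in>UNIV. (dual i x \<bullet> s) * (\<Sum>j\<in>UNIV. (dual j x \<bullet> t) * (\<Sum>k\<in>UNIV. (dual k x \<bullet> r) * (u2 i j x \<bullet> u1 k x))))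
    = Q s t x \<bullet> P r x"
  unfolding Q_inner by (simp add: inner_P)

lemma hat_u1_u2:
  "(\<Sum>i\<in>UNIV. (dual i x \<bullet> s) * (\<Sum>j\<in>UNIV. (dual j x \<bullet> t) * (\<Sum>k\<in>UNIV. (dual k x \<bullet> r) * (u2 j k x \<bullet> u1 i x))))
    = Q t r x \<bullet> P s x"
  by (simp add: inner_P Q_inner)

lemma hat_dg:
  "(\<Sum>i\<in>UNIV. (dual i x \<bullet> s) * (\<Sum>j\<in>UNIV. (dual j x \<bullet> t) * (\<Sum>k\<in>UNIV. (dual k x \<bullet> r) * dg i j k x)))
    = Q s r x \<bullet> P t x + Q s t x \<bullet> P r x"
proof -
  have "(\<Sum>i\<in>UNIV. (dual i x \<bullet> s) * (\<Sum>j\<in>UNIV. (dual j x \<bullet> t) * (\<Sum>k\<in>UNIV. (dual k x \<bullet> r) * (u2 i k x \<bullet> u1 j x))))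
    = Q s r x \<bullet> P t x"
    unfolding Q_inner[of s r] unfolding inner_P sum_distrib_left
    by (rule sum.cong[OF refl]) (subst sum.swap, simp add: mult_ac)
  then show ?thesis
    unfolding dg_def hat_u2_u1[symmetric]
    by (simp add: distrib_left sum.distrib inner_commute[of "u1 _ _"])
qed

text \<open>Inserting the formula for the derivative of an inverse matrix and reordering gives two
  of the three layers of the nested sum in \<open>G_contract3\<close>.\<close>

lemma dG_contract:
  "(\<Sum>i\<in>UNIV. \<Sum>j\<in>UNIV. dG k i j x * h i j) =
    - (\<Sum>a\<in>UNIV. \<Sum>i\<in>UNIV. G a i x * (\<Sum>b\<in>UNIV. \<Sum>j\<in>UNIV. G b j x * (dg k a b x * h i j)))"
proof -
  have "(\<Sum>i\<in>UNIV. \<Sum>j\<in>UNIV. dG k i j x * h i j) =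
     - (\<Sum>i\<in>UNIV. \<Sum>j\<in>UNIV. \<Sum>a\<in>UNIV. \<Sum>b\<in>UNIV. G a i x * (G b j x * (dg k a b x * h i j)))"
    unfolding dG_def minus_mult_left[symmetric] sum_negf sum_distrib_right
    by (simp add: mult_ac G_commute)
  also have "(\<Sum>i\<in>UNIV. \<Sum>j\<in>UNIV. \<Sum>a\<in>UNIV. \<Sum>b\<in>UNIV. G a i x * (G b j x * (dg k a b x * h i j)))
     = (\<Sum>i\<in>UNIV. \<Sum>a\<in>UNIV. \<Sum>j\<in>UNIV. \<Sum>b\<in>UNIV. G a i x * (G b j x * (dg k a b x * h i j)))"
    by (intro sum.cong refl sum.swap)
  also have "\<dots> = (\<Sum>a\<in>UNIV. \<Sum>i\<in>UNIV. \<Sum>j\<in>UNIV. \<Sum>b\<in>UNIV. G a i x * (G b j x * (dg k a b x * h i j)))"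
    by (rule sum.swap)
  also have "\<dots> = (\<Sum>a\<in>UNIV. \<Sum>i\<in>UNIV. \<Sum>b\<in>UNIV. \<Sum>j\<in>UNIV. G a i x * (G b j x * (dg k a b x * h i j)))"
    by (intro sum.cong refl sum.swap)
  finally show ?thesis by (simp add: sum_distrib_left)
qed

text \<open>Differentiating the factor \<open>x $ k\<close> produces the first derivative of
  \<open>u\<close> in direction \<open>i\<close>, which cancels against the one from the
  zeroth-order term.\<close>

lemma self_shrinker_equation_derivative:
  assumes "self_shrinker u"
  shows "(\<Sum>k\<in>UNIV. \<Sum>l\<in>UNIV. G k l x *\<^sub>R u3 i k l x) - (1/2) *\<^sub>R (\<Sum>k\<in>UNIV. x $ k *\<^sub>R u2 i k x)
    = - (\<Sum>k\<in>UNIV. \<Sum>l\<in>UNIV. dG i k l x *\<^sub>R u2 k l x)"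
proof -
  have "has_pd i (\<lambda>x. \<Sum>k\<in>UNIV. \<Sum>l\<in>UNIV. G k l x *\<^sub>R u2 k l x)
     (\<Sum>k\<in>UNIV. \<Sum>l\<in>UNIV. G k l x *\<^sub>R u3 i k l x + dG i k l x *\<^sub>R u2 k l x) x"
    by (intro has_pd_sum has_pd_scaleR has_pd_G has_pd_u2)
  moreover have "has_pd i (\<lambda>x. (1/2) *\<^sub>R ((\<Sum>k\<in>UNIV. x $ k *\<^sub>R u1 k x) - u x))
     ((1/2) *\<^sub>R ((\<Sum>k\<in>UNIV. x $ k *\<^sub>R u2 i k x + (if k = i then 1 else 0) *\<^sub>R u1 k x) - u1 i x)) x"
    by (intro has_pd_bounded_linear[OF bounded_linear_scaleR_right] has_pd_diff has_pd_sum has_pd_scaleR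
        has_pd_nth has_pd_u1 has_pd_u)
  ultimately have "(\<Sum>k\<in>UNIV. \<Sum>l\<in>UNIV. G k l x *\<^sub>R u3 i k l x + dG i k l x *\<^sub>R u2 k l x) =
     (1/2) *\<^sub>R ((\<Sum>k\<in>UNIV. x $ k *\<^sub>R u2 i k x + (if k = i then 1 else 0) *\<^sub>R u1 k x) - u1 i x)"
    unfolding self_shrinker_equation[OF assms] by (rule has_pd_unique)
  moreover have "(\<Sum>k\<in>UNIV. (if k = i then 1 else 0) *\<^sub>R u1 k x) = (\<Sum>k\<in>UNIV. if k = i then u1 k x else 0)"
    by (intro sum.cong) auto
  ultimately show ?thesis by (simp add: sum.distrib algebra_simps)
qed

end

section \<open>The drift Laplacian of the area density\<close>

context smooth_graph
begin

text \<open>\<open>u2 i j x \<bullet> u1 k x\<close> is the Christoffel symbol of the first kind of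
  the graph metric; \<open>T\<close> is its form in the ambient basis.\<close>

definition T :: "real^'n \<Rightarrow> (real^'n) \<times> (real^'m) \<Rightarrow> (real^'n) \<times> (real^'m) \<Rightarrow> (real^'n) \<times> (real^'m) \<Rightarrow> real" where
  "T x s t r = Q s t x \<bullet> P r x"

lemma T_commute: "T x s t r = T x t s r"
  by (simp add: T_def Q_commute)

lemma dG_term:
  "(\<Sum>k\<in>UNIV. \<Sum>l\<in>UNIV. G k l x * (\<Sum>i\<in>UNIV. \<Sum>j\<in>UNIV. dG k i j x * (u2 l i x \<bullet> u1 j x))) =
    - (\<Sum>s\<in>Basis. \<Sum>t\<in>Basis. \<Sum>r\<in>Basis. (T x s r t + T x s t r) * T x s t r)"
proof -
  have "(\<Sum>k\<in>UNIV. \<Sum>l\<in>UNIV. G k l x * (\<Sum>i\<in>UNIV. \<Sum>j\<in>UNIV. dG k i j x * (u2 l i x \<bullet> u1 j x))) =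
    - (\<Sum>k\<in>UNIV. \<Sum>l\<in>UNIV. G k l x * (\<Sum>a\<in>UNIV. \<Sum>i\<in>UNIV. G a i x *
        (\<Sum>b\<in>UNIV. \<Sum>j\<in>UNIV. G b j x * (dg k a b x * (u2 l i x \<bullet> u1 j x)))))"
    by (simp only: dG_contract mult_minus_right sum_negf)
  also have "\<dots> = - (\<Sum>s\<in>Basis. \<Sum>t\<in>Basis. \<Sum>r\<in>Basis. (T x s r t + T x s t r) * T x s t r)"
    by (simp only: G_contract3[where f = "\<lambda>k a b. dg k a b x" and h = "\<lambda>l i j. u2 l i x \<bullet> u1 j x"]
        hat_dg hat_u2_u1 T_def)
  finally show ?thesis .
qed

lemma u2_term:
  "(\<Sum>k\<in>UNIV. \<Sum>l\<in>UNIV. G k l x * (\<Sum>i\<in>UNIV. \<Sum>j\<in>UNIV. G i j x * (u2 l i x \<bullet> u2 k j x))) =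
    (\<Sum>s\<in>Basis. \<Sum>t\<in>Basis. Q s t x \<bullet> Q s t x)"
proof -
  define R where "R l t = (\<Sum>i\<in>UNIV. (dual i x \<bullet> t) *\<^sub>R u2 l i x)" for l t
  have "(\<Sum>i\<in>UNIV. \<Sum>j\<in>UNIV. G i j x * (u2 l i x \<bullet> u2 k j x)) = (\<Sum>t\<in>Basis. R k t \<bullet> R l t)" for k l
    by (rule trans[OF G_contract]) (unfold R_def[symmetric], simp only: inner_commute)
  then have "(\<Sum>k\<in>UNIV. \<Sum>l\<in>UNIV. G k l x * (\<Sum>i\<in>UNIV. \<Sum>j\<in>UNIV. G i j x * (u2 l i x \<bullet> u2 k j x))) =
     (\<Sum>k\<in>UNIV. \<Sum>l\<in>UNIV. G k l x * (\<Sum>t\<in>Basis. R k t \<bullet> R l t))"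
    by simp
  also have "\<dots> = (\<Sum>t\<in>Basis. \<Sum>k\<in>UNIV. \<Sum>l\<in>UNIV. G k l x * (R k t \<bullet> R l t))"
    by (rule sum_pull)
  also have "\<dots> = (\<Sum>t\<in>Basis. \<Sum>s\<in>Basis. Q s t x \<bullet> Q s t x)"
    unfolding Q_def R_def[symmetric] by (rule sum.cong[OF refl G_contract])
  also have "\<dots> = (\<Sum>s\<in>Basis. \<Sum>t\<in>Basis. Q s t x \<bullet> Q s t x)"
    by (rule sum.swap)
  finally show ?thesis .
qed

text \<open>Total symmetry of the third derivatives moves the metric trace onto two indices of
  \<open>u3 i\<close>, where the differentiated shrinker equation applies.\<close>

lemma sum_u3_inner:
  "(\<Sum>k\<in>UNIV. \<Sum>l\<in>UNIV. G k l x * (\<Sum>i\<in>UNIV. \<Sum>j\<in>UNIV. G i j x * (u3 k l i x \<bullet> u1 j x))) =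
    (\<Sum>i\<in>UNIV. \<Sum>j\<in>UNIV. G i j x * ((\<Sum>k\<in>UNIV. \<Sum>l\<in>UNIV. G k l x *\<^sub>R u3 i k l x) \<bullet> u1 j x))"
proof -
  have "(\<Sum>k\<in>UNIV. \<Sum>l\<in>UNIV. G k l x * (\<Sum>i\<in>UNIV. \<Sum>j\<in>UNIV. G i j x * (u3 k l i x \<bullet> u1 j x))) =
     (\<Sum>i\<in>UNIV. \<Sum>j\<in>UNIV. \<Sum>k\<in>UNIV. \<Sum>l\<in>UNIV. G k l x * (G i j x * (u3 k l i x \<bullet> u1 j x)))"
    by (rule trans[OF sum_pull], rule sum.cong[OF refl], rule sum_pull)
  moreover have "u3 k l i x = u3 i k l x" for k l i
    by (metis u3_commute)
  ultimately show ?thesis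
    by (simp add: inner_sum_left sum_distrib_left mult_ac)
qed

lemma sum_x_V:
  "(\<Sum>k\<in>UNIV. x $ k * V k x) =
    (\<Sum>i\<in>UNIV. \<Sum>j\<in>UNIV. G i j x * ((\<Sum>k\<in>UNIV. x $ k *\<^sub>R u2 i k x) \<bullet> u1 j x))"
proof -
  have "(\<Sum>k\<in>UNIV. x $ k * V k x) =
    (\<Sum>k\<in>UNIV. \<Sum>i\<in>UNIV. \<Sum>j\<in>UNIV. G i j x * (x $ k * (u2 i k x \<bullet> u1 j x)))"
    by (simp add: V_def sum_distrib_left mult_ac u2_commute)
  also have "\<dots> = (\<Sum>i\<in>UNIV. \<Sum>j\<in>UNIV. G i j x * (\<Sum>k\<in>UNIV. x $ k * (u2 i k x \<bullet> u1 j x)))"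
    by (rule sum_pull[symmetric])
  finally show ?thesis by (simp add: inner_sum_left)
qed

text \<open>The differentiated shrinker equation trades the third derivatives and the drift together
  for terms quadratic in the second derivatives.\<close>

lemma u3_term:
  assumes "self_shrinker u"
  shows "(\<Sum>k\<in>UNIV. \<Sum>l\<in>UNIV. G k l x * (\<Sum>i\<in>UNIV. \<Sum>j\<in>UNIV. G i j x * (u3 k l i x \<bullet> u1 j x)))
      - (1/2) * (\<Sum>k\<in>UNIV. x $ k * V k x) =
    (\<Sum>s\<in>Basis. \<Sum>t\<in>Basis. \<Sum>r\<in>Basis. (T x s r t + T x s t r) * T x t r s)"
proof -
  have "(\<Sum>k\<in>UNIV. \<Sum>l\<in>UNIV. G k l x * (\<Sum>i\<in>UNIV. \<Sum>j\<in>UNIV. G i j x * (u3 k l i x \<bullet> u1 j x)))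
      - (1/2) * (\<Sum>k\<in>UNIV. x $ k * V k x) =
    (\<Sum>i\<in>UNIV. \<Sum>j\<in>UNIV. G i j x * (((\<Sum>k\<in>UNIV. \<Sum>l\<in>UNIV. G k l x *\<^sub>R u3 i k l x)
        - (1/2) *\<^sub>R (\<Sum>k\<in>UNIV. x $ k *\<^sub>R u2 i k x)) \<bullet> u1 j x))"
    unfolding sum_u3_inner sum_x_V inner_diff_left right_diff_distrib sum_subtractf sum_distrib_left[of "1/2"]
    by (simp add: mult_ac)
  also have "\<dots> = (\<Sum>i\<in>UNIV. \<Sum>j\<in>UNIV. G i j x * - (\<Sum>k\<in>UNIV. \<Sum>l\<in>UNIV. dG i k l x * (u2 k l x \<bullet> u1 j x)))"
    unfolding self_shrinker_equation_derivative[OF assms] by (simp add: inner_sum_left)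
  also have "\<dots> = (\<Sum>i\<in>UNIV. \<Sum>j\<in>UNIV. G i j x * (\<Sum>a\<in>UNIV. \<Sum>k\<in>UNIV. G a k x *
        (\<Sum>b\<in>UNIV. \<Sum>l\<in>UNIV. G b l x * (dg i a b x * (u2 k l x \<bullet> u1 j x)))))"
    by (simp only: dG_contract minus_minus)
  also have "\<dots> = (\<Sum>s\<in>Basis. \<Sum>t\<in>Basis. \<Sum>r\<in>Basis. (T x s r t + T x s t r) * T x t r s)"
    by (simp only: G_contract3[where f = "\<lambda>k a b. dg k a b x" and h = "\<lambda>j k l. u2 k l x \<bullet> u1 j x"]
        hat_dg hat_u1_u2 T_def)
  finally show ?thesis .
qed

text \<open>\<open>S\<close> is the product of the shape operators of the normals for
  \<open>a\<close> and \<open>b\<close>, with lowered indices; both factors being symmetric, they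
  commute exactly when \<open>S\<close> is symmetric.\<close>

lemma flat_frame:
  assumes "flat_normal_bundle u"
  shows "(\<Sum>s\<in>Basis. (Q s t x \<bullet> a) * (Q s r x \<bullet> b)) = (\<Sum>s\<in>Basis. (Q s r x \<bullet> a) * (Q s t x \<bullet> b))"
proof -
  define S where "S i j = (\<Sum>k\<in>UNIV. \<Sum>l\<in>UNIV. G k l x * ((u2 i k x \<bullet> a) * (u2 j l x \<bullet> b)))" for i j
  have S: "S i j = S j i" for i j
    using flat_normal_bundle_shape_operators_commute[OF assms, of x i a j b] by (simp add: S_def mult.assoc)
  define R where "R c i s = (\<Sum>k\<in>UNIV. (dual k x \<bullet> s) * (u2 i k x \<bullet> c))" for c i s
  have Q: "Q s t x \<bullet> c = (\<Sum>i\<in>UNIV. (dual i x \<bullet> t) * R c i s)" for s t c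
    unfolding R_def Q_commute[of s t] Q_inner ..
  have "(\<Sum>s\<in>Basis. (Q s t x \<bullet> a) * (Q s r x \<bullet> b)) =
      (\<Sum>i\<in>UNIV. \<Sum>j\<in>UNIV. ((dual i x \<bullet> t) * (dual j x \<bullet> r)) * S i j)" for t r
  proof -
    have "S i j = (\<Sum>s\<in>Basis. R a i s * R b j s)" for i j
      unfolding S_def R_def by (rule G_contract_real)
    then have "(\<Sum>i\<in>UNIV. \<Sum>j\<in>UNIV. ((dual i x \<bullet> t) * (dual j x \<bullet> r)) * S i j) =
       (\<Sum>s\<in>Basis. \<Sum>i\<in>UNIV. \<Sum>j\<in>UNIV. ((dual i x \<bullet> t) * (dual j x \<bullet> r)) * (R a i s * R b j s))"
      by (simp only: sum_pull)
    then show ?thesis unfolding Q sum_product by (simp only: mult_ac)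
  qed
  moreover have "(\<Sum>i\<in>UNIV. \<Sum>j\<in>UNIV. ((dual i x \<bullet> t) * (dual j x \<bullet> r)) * S i j) =
      (\<Sum>i\<in>UNIV. \<Sum>j\<in>UNIV. ((dual i x \<bullet> r) * (dual j x \<bullet> t)) * S i j)"
    by (subst sum.swap) (simp add: S mult.commute)
  ultimately show ?thesis by simp
qed

lemma grad_term:
  "(\<Sum>k\<in>UNIV. \<Sum>l\<in>UNIV. G k l x * (V k x * V l x)) =
    (\<Sum>s\<in>Basis. (\<Sum>t\<in>Basis. T x s t t) * (\<Sum>t\<in>Basis. T x s t t))"
proof -
  have "(\<Sum>k\<in>UNIV. (dual k x \<bullet> s) * V k x) = (\<Sum>t\<in>Basis. T x s t t)" for s
  proof -
    have "V k x = (\<Sum>t\<in>Basis. (\<Sum>i\<in>UNIV. (dual i x \<bullet> t) *\<^sub>R u2 k i x) \<bullet> P t x)" for k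
      unfolding V_def P_def by (rule G_contract)
    then have "(\<Sum>k\<in>UNIV. (dual k x \<bullet> s) * V k x) =
       (\<Sum>t\<in>Basis. \<Sum>k\<in>UNIV. (dual k x \<bullet> s) * ((\<Sum>i\<in>UNIV. (dual i x \<bullet> t) *\<^sub>R u2 k i x) \<bullet> P t x))"
      by (subst sum.swap) (simp add: sum_distrib_left)
    then show ?thesis by (simp add: T_def Q_def inner_sum_left)
  qed
  then show ?thesis by (simp only: G_contract_real)
qed

text \<open>Flatness acts here: it turns the mixed sum of \<open>T\<close> into a sum of squared
  traces, which \<open>grad_term\<close> identifies as the gradient term.\<close>

lemma flat_grad_term:
  assumes "flat_normal_bundle u"
  shows "(\<Sum>s\<in>Basis. \<Sum>t\<in>Basis. \<Sum>r\<in>Basis. T x s r t * T x s t r) =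
    (\<Sum>s\<in>Basis. (\<Sum>t\<in>Basis. T x s t t) * (\<Sum>t\<in>Basis. T x s t t))"
proof -
  \<comment> \<open>At the fixed point \<open>x\<close> the normals are chosen by
    \<open>a = P t x\<close> and \<open>b = P r x\<close>.\<close>
  have flat: "(\<Sum>s\<in>Basis. T x s r t * T x s t r) = (\<Sum>s\<in>Basis. T x s t t * T x s r r)" for t r
    unfolding T_def by (rule flat_frame[OF assms])
  have pull: "(\<Sum>s\<in>Basis. \<Sum>t\<in>Basis. \<Sum>r\<in>Basis. f s t r) = (\<Sum>t\<in>Basis. \<Sum>r\<in>Basis. \<Sum>s\<in>Basis. f s t r)"
    for f :: "(real^'n) \<times> (real^'m) \<Rightarrow> (real^'n) \<times> (real^'m) \<Rightarrow> (real^'n) \<times> (real^'m) \<Rightarrow> real"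
    by (rule trans[OF sum.swap], rule sum.cong[OF refl], rule sum.swap)
  have "(\<Sum>s\<in>Basis. \<Sum>t\<in>Basis. \<Sum>r\<in>Basis. T x s r t * T x s t r) =
      (\<Sum>t\<in>Basis. \<Sum>r\<in>Basis. \<Sum>s\<in>Basis. T x s r t * T x s t r)"
    by (rule pull)
  also have "\<dots> = (\<Sum>t\<in>Basis. \<Sum>r\<in>Basis. \<Sum>s\<in>Basis. T x s t t * T x s r r)"
    by (simp only: flat)
  also have "\<dots> = (\<Sum>s\<in>Basis. \<Sum>t\<in>Basis. \<Sum>r\<in>Basis. T x s t t * T x s r r)"
    by (rule pull[symmetric])
  finally show ?thesis by (simp only: sum_product)
qed

text \<open>The left side is the drift Laplacian of the function with gradient \<open>V\<close>. Of
  the two sums that \<open>trilinear_collapse\<close> leaves, one completes \<open>sff_sq x\<close>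
  and the other is the gradient term.\<close>

lemma drift_identity:
  assumes "self_shrinker u" "flat_normal_bundle u"
  shows "(\<Sum>k\<in>UNIV. \<Sum>l\<in>UNIV. G k l x * dV k l x) - (1/2) * (\<Sum>k\<in>UNIV. x $ k * V k x) =
    sff_sq x + (\<Sum>k\<in>UNIV. \<Sum>l\<in>UNIV. G k l x * (V k x * V l x))"
proof -
  have "(\<Sum>k\<in>UNIV. \<Sum>l\<in>UNIV. G k l x * dV k l x) =
     (\<Sum>k\<in>UNIV. \<Sum>l\<in>UNIV. G k l x * (\<Sum>i\<in>UNIV. \<Sum>j\<in>UNIV. G i j x * (u2 l i x \<bullet> u2 k j x))) +
     (\<Sum>k\<in>UNIV. \<Sum>l\<in>UNIV. G k l x * (\<Sum>i\<in>UNIV. \<Sum>j\<in>UNIV. G i j x * (u3 k l i x \<bullet> u1 j x))) +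
     (\<Sum>k\<in>UNIV. \<Sum>l\<in>UNIV. G k l x * (\<Sum>i\<in>UNIV. \<Sum>j\<in>UNIV. dG k i j x * (u2 l i x \<bullet> u1 j x)))"
    by (simp add: dV_def distrib_left sum.distrib)
  then have "(\<Sum>k\<in>UNIV. \<Sum>l\<in>UNIV. G k l x * dV k l x) - (1/2) * (\<Sum>k\<in>UNIV. x $ k * V k x) =
     (\<Sum>s\<in>Basis. \<Sum>t\<in>Basis. Q s t x \<bullet> Q s t x) +
     ((\<Sum>s\<in>Basis. \<Sum>t\<in>Basis. \<Sum>r\<in>Basis. (T x s r t + T x s t r) * T x t r s) -
      (\<Sum>s\<in>Basis. \<Sum>t\<in>Basis. \<Sum>r\<in>Basis. (T x s r t + T x s t r) * T x s t r))"
    using u3_term[OF assms(1), of x] unfolding u2_term dG_term by linarith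
  also have "(\<Sum>s\<in>Basis. \<Sum>t\<in>Basis. \<Sum>r\<in>Basis. (T x s r t + T x s t r) * T x t r s) -
      (\<Sum>s\<in>Basis. \<Sum>t\<in>Basis. \<Sum>r\<in>Basis. (T x s r t + T x s t r) * T x s t r) =
      (\<Sum>s\<in>Basis. \<Sum>t\<in>Basis. \<Sum>r\<in>Basis. (T x s r t + T x s t r) * (T x t r s - T x s t r))"
    by (simp only: right_diff_distrib sum_subtractf)
  also have "\<dots> = (\<Sum>s\<in>Basis. \<Sum>t\<in>Basis. \<Sum>r\<in>Basis. T x s r t * T x s t r) -
      (\<Sum>s\<in>Basis. \<Sum>t\<in>Basis. \<Sum>r\<in>Basis. T x s t r * T x s t r)"
    by (rule trilinear_collapse) (rule T_commute)
  also have "(\<Sum>s\<in>Basis. \<Sum>t\<in>Basis. \<Sum>r\<in>Basis. T x s r t * T x s t r) =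
      (\<Sum>k\<in>UNIV. \<Sum>l\<in>UNIV. G k l x * (V k x * V l x))"
    unfolding flat_grad_term[OF assms(2)] grad_term ..
  finally show ?thesis
    by (simp add: sff_sq_def sum_subtractf T_def)
qed

section \<open>The norm of the second fundamental form\<close>

lemma nproj_inner_X: "nproj u x v \<bullet> X i x = 0"
proof -
  have "(\<Sum>k\<in>UNIV. (v \<bullet> dual k x) * (X k x \<bullet> X i x)) = v \<bullet> (\<Sum>k\<in>UNIV. (X k x \<bullet> X i x) *\<^sub>R dual k x)"
    by (simp add: inner_sum_right mult.commute)
  also have "(\<Sum>k\<in>UNIV. (X k x \<bullet> X i x) *\<^sub>R dual k x) = (\<Sum>c\<in>UNIV. (dual c x \<bullet> X i x) *\<^sub>R X c x)"
    unfolding dual_def inner_sum_left scaleR_sum_right scaleR_sum_left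
    by (subst sum.swap) (simp add: G_commute mult.commute)
  also have "\<dots> = (\<Sum>c\<in>UNIV. if c = i then X c x else 0)"
    by (intro sum.cong) (auto simp: dual_inner_X)
  finally show ?thesis by (simp add: nproj_eq inner_diff_left inner_sum_left)
qed

text \<open>The projection is orthogonal, so the squared length of the tangential part is
  subtracted; the ambient basis expresses it through \<open>P\<close>.\<close>

lemma nproj_norm_sq:
  "nproj u x (0, a) \<bullet> nproj u x (0, a) = a \<bullet> a - (\<Sum>r\<in>Basis. (a \<bullet> P r x) * (a \<bullet> P r x))"
proof -
  have "nproj u x (0, a) \<bullet> nproj u x (0, a) = (0, a) \<bullet> nproj u x (0, a)"
    by (rule nproj_inner_normal) (rule nproj_inner_X)
  also have "\<dots> = a \<bullet> a - (\<Sum>k\<in>UNIV. ((0, a) \<bullet> dual k x) * (a \<bullet> u1 k x))"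
    by (simp add: nproj_eq inner_diff_right inner_sum_right X_def)
  also have "(\<Sum>k\<in>UNIV. ((0, a) \<bullet> dual k x) * (a \<bullet> u1 k x)) =
      (\<Sum>k\<in>UNIV. \<Sum>l\<in>UNIV. G k l x * ((a \<bullet> u1 k x) * (a \<bullet> u1 l x)))"
    by (simp add: dual_def X_def inner_sum_right sum_distrib_left mult_ac)
  also have "\<dots> = (\<Sum>r\<in>Basis. (a \<bullet> P r x) * (a \<bullet> P r x))"
    unfolding inner_P by (rule G_contract_real)
  finally show ?thesis .
qed

text \<open>\<open>nproj u x (0, Q s t x)\<close> is the second fundamental form on the tangential
  parts of \<open>s\<close> and \<open>t\<close>.\<close>

lemma sff_sq_eq: "sff_sq x = (\<Sum>s\<in>Basis. \<Sum>t\<in>Basis. (norm (nproj u x (0, Q s t x)))\<^sup>2)"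
  by (simp only: sff_sq_def power2_norm_eq_inner nproj_norm_sq)

lemma sff_sq_nonneg: "sff_sq x \<ge> 0"
  unfolding sff_sq_eq by (intro sum_nonneg) simp

text \<open>Expanding \<open>X k x\<close> in the ambient basis recovers \<open>v k\<close> from the
  contractions, because \<open>X\<close> and \<open>dual\<close> are dual bases.\<close>

lemma frame_injective:
  assumes "\<And>s. s \<in> Basis \<Longrightarrow> (\<Sum>i\<in>UNIV. (dual i x \<bullet> s) *\<^sub>R (v i :: 'b::real_vector)) = 0"
  shows "v k = 0"
proof -
  have "(\<Sum>s\<in>Basis. (X k x \<bullet> s) * (dual i x \<bullet> s)) = (if k = i then 1 else 0)" for i
    using dual_inner_X[of i x k] by (subst euclidean_inner[symmetric]) (auto simp: inner_commute)
  moreover have "v k = (\<Sum>i\<in>UNIV. if k = i then v i else 0)" by simp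
  moreover have "\<dots> = (\<Sum>i\<in>UNIV. (if k = i then 1 else 0) *\<^sub>R v i)"
    by (intro sum.cong) auto
  ultimately have "v k = (\<Sum>i\<in>UNIV. (\<Sum>s\<in>Basis. (X k x \<bullet> s) * (dual i x \<bullet> s)) *\<^sub>R v i)"
    by simp
  also have "\<dots> = (\<Sum>s\<in>Basis. (X k x \<bullet> s) *\<^sub>R (\<Sum>i\<in>UNIV. (dual i x \<bullet> s) *\<^sub>R v i))"
    unfolding scaleR_sum_left scaleR_sum_right by (subst sum.swap) simp
  finally show ?thesis using assms by simp
qed

lemma sff_sq_zero:
  assumes "sff_sq x = 0"
  shows "u2 k l x = 0"
proof -
  have Q0: "Q s t x = 0" if "s \<in> Basis" "t \<in> Basis" for s t
  proof -
    have "(\<Sum>t\<in>Basis. (norm (nproj u x (0, Q s t x)))\<^sup>2) = 0"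
      using assms that(1) unfolding sff_sq_eq by (subst (asm) sum_nonneg_eq_0_iff) (auto intro: sum_nonneg)
    then have "nproj u x (0, Q s t x) = 0"
      using that(2) by (subst (asm) sum_nonneg_eq_0_iff) auto
    \<comment> \<open>As the horizontal component is zero, this pairing is the squared norm of
      \<open>Q s t x\<close>.\<close>
    then have "(0, Q s t x) \<bullet> nu (Q s t x) x = 0"
      using nproj_inner_normal[OF nu_normal, of x "(0, Q s t x)" "Q s t x"] by simp
    then show ?thesis by (simp add: inner_nu)
  qed
  have "(\<Sum>l\<in>UNIV. (dual l x \<bullet> t) *\<^sub>R u2 k l x) = 0" if "t \<in> Basis" for t k
    by (rule frame_injective[where x = x and v = "\<lambda>k. \<Sum>l\<in>UNIV. (dual l x \<bullet> t) *\<^sub>R u2 k l x"])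
      (use Q0 that in \<open>simp add: Q_def\<close>)
  then show ?thesis by (rule frame_injective[where x = x and v = "\<lambda>l. u2 k l x"])
qed

section \<open>The reciprocal area density and its derivatives\<close>

text \<open>This is \<open>(det g)\<close> to the power \<open>-1/2\<close>; squaring avoids having to know the sign of the determinant.\<close>

definition W :: "real^'n \<Rightarrow> real" where
  "W x = exp (- (1/4) * ln ((det (gmat u x))\<^sup>2))"

lemma W_pos: "W x > 0"
  by (simp add: W_def)

lemma has_pd_W: "has_pd l W (- (W x * V l x)) x"
proof -
  let ?D = "det (gmat u x)"
  have tr: "(\<Sum>i\<in>UNIV. \<Sum>j\<in>UNIV. matrix_inv (gmat u x) $ j $ i * dg l i j x) = 2 * V l x"
  proof -
    have "(\<Sum>i\<in>UNIV. \<Sum>j\<in>UNIV. G i j x * (u1 i x \<bullet> u2 l j x)) = V l x"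
      unfolding V_def by (subst sum.swap) (simp add: G_commute inner_commute)
    moreover have "(\<Sum>i\<in>UNIV. \<Sum>j\<in>UNIV. matrix_inv (gmat u x) $ j $ i * dg l i j x) =
       (\<Sum>i\<in>UNIV. \<Sum>j\<in>UNIV. G i j x * dg l i j x)"
      by (simp add: G_def[symmetric] G_commute)
    ultimately show ?thesis by (simp add: dg_def distrib_left sum.distrib V_def)
  qed
  have "?D * ?D > 0" using det_gmat_nonzero[of x] by (metis not_real_square_gt_zero)
  then have "((\<lambda>D. exp (- (1/4) * ln (D\<^sup>2))) has_real_derivative (W x * (- (1/2) / ?D))) (at ?D)"
    using det_gmat_nonzero[of x] unfolding W_def
    by (auto intro!: derivative_eq_intros simp: field_simps power2_eq_square)
  from has_pd_chain[OF has_pd_det_inverse[OF has_pd_gmat[of l] det_gmat_nonzero] this]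
  have "has_pd l W (W x * (- (1/2) / ?D) * (?D * (2 * V l x))) x"
    unfolding W_def[symmetric] tr .
  then show ?thesis using det_gmat_nonzero[of x] by simp
qed

lemma has_pd_V: "has_pd k (V l) (dV k l x) x"
  unfolding V_def dV_def by (intro has_pd_sum has_pd_mult has_pd_inner has_pd_G has_pd_u1 has_pd_u2)

lemma V_continuous: "continuous_on S (V k)" "continuous_on S (dV k l)"
  unfolding V_def dV_def dG_def dg_def by (intro continuous_intros G_continuous u_continuous)+

lemma W_continuous: "continuous_on S W"
  unfolding W_def by (intro continuous_intros continuous_on_det gmat_continuous) (auto simp: det_gmat_nonzero)

definition W1 :: "'n \<Rightarrow> real^'n \<Rightarrow> real" where "W1 l x = - (W x * V l x)"
definition W2 :: "'n \<Rightarrow> 'n \<Rightarrow> real^'n \<Rightarrow> real" where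
  "W2 l k x = - (W x * dV k l x + - (W x * V k x) * V l x)"

lemma has_pd_W1: "has_pd k (W1 l) (W2 l k x) x"
  unfolding W1_def W2_def by (intro has_pd_minus has_pd_mult has_pd_W has_pd_V)

lemma C2_W: "C2_with W W1 W2"
  unfolding C2_with_def
proof (intro conjI allI has_derivative_continuous_partials)
  show "has_pd i W (W1 i x) x" for i x unfolding W1_def by (rule has_pd_W)
  show "continuous_on UNIV (W1 i)" for i
    unfolding W1_def by (intro continuous_intros W_continuous V_continuous)
  show "has_pd j (W1 i) (W2 i j x) x" for i j x by (rule has_pd_W1)
  show "continuous_on UNIV (W2 i j)" for i j
    unfolding W2_def by (intro continuous_intros W_continuous V_continuous)
qed

end

section \<open>Rigidity from the minimum principles\<close>

sublocale smooth_graph \<subseteq> drift_operator dual "\<lambda>i x. - (1/2) * x $ i"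
  by unfold_locales (intro dual_continuous, intro continuous_intros)

context smooth_graph
begin

text \<open>Two derivatives of \<open>W\<close> give \<open>W\<close> times the product of two
  components of \<open>V\<close> minus \<open>dV\<close>; after inserting
  \<open>drift_identity\<close> the gradient terms cancel.\<close>

lemma L_W:
  assumes "self_shrinker u" "flat_normal_bundle u"
  shows "L W1 W2 x = - (W x * sff_sq x)"
proof -
  have "(\<Sum>i\<in>UNIV. \<Sum>j\<in>UNIV. G i j x * dV j i x) = (\<Sum>k\<in>UNIV. \<Sum>l\<in>UNIV. G k l x * dV k l x)"
    by (subst sum.swap) (simp add: G_commute)
  moreover have "(\<Sum>i\<in>UNIV. \<Sum>j\<in>UNIV. G i j x * W2 i j x) =
      W x * (\<Sum>k\<in>UNIV. \<Sum>l\<in>UNIV. G k l x * (V k x * V l x)) - W x * (\<Sum>i\<in>UNIV. \<Sum>j\<in>UNIV. G i j x * dV j i x)"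
    by (simp add: W2_def sum_distrib_left sum_subtractf algebra_simps)
  moreover have "(\<Sum>i\<in>UNIV. - (1/2) * x $ i * W1 i x) = W x * ((1/2) * (\<Sum>k\<in>UNIV. x $ k * V k x))"
    by (simp add: W1_def sum_distrib_left mult_ac)
  ultimately have "L W1 W2 x = W x * ((\<Sum>k\<in>UNIV. \<Sum>l\<in>UNIV. G k l x * (V k x * V l x))
      - ((\<Sum>k\<in>UNIV. \<Sum>l\<in>UNIV. G k l x * dV k l x) - (1/2) * (\<Sum>k\<in>UNIV. x $ k * V k x)))"
    unfolding L_def dual_inner_dual by (simp only: right_diff_distrib)
  then show ?thesis unfolding drift_identity[OF assms] by simp
qed

text \<open>Once \<open>W\<close> is constant, \<open>L W1 W2\<close> vanishes, and positivity of
  \<open>W\<close> passes this on to \<open>sff_sq\<close>.\<close>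

lemma hessian_zero:
  assumes "self_shrinker u" "flat_normal_bundle u"
  shows "u2 k l x = 0"
proof -
  have super: "L W1 W2 x \<le> 0" for x
    unfolding L_W[OF assms] using W_pos[of x] sff_sq_nonneg[of x] by simp
  obtain x0 where "\<And>x. W x0 \<le> W x"
    by (rule confining_supersolution_attains_min[OF C2_W super])
      (auto simp: W_pos less_imp_le dual_inner_dual G_diag_le_1)
  then have "W x = W x0" for x
    by (intro strong_minimum_principle[OF C2_W super dual_independent])
  then have "W = (\<lambda>x. W x0)" by auto
  then have "has_pd i W 0 x" for i x by (metis has_pd_const)
  then have "W1 i x = 0" for i x
    unfolding W1_def using has_pd_W has_pd_unique by blast
  then have W1: "W1 i = (\<lambda>x. 0)" for i by auto
  then have "has_pd j (W1 i) 0 x" for i j x by (simp add: has_pd_const)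
  then have "W2 i j x = 0" for i j x using has_pd_W1 has_pd_unique by blast
  then have "L W1 W2 x = 0" unfolding L_def by (simp add: W1)
  then have "sff_sq x = 0" unfolding L_W[OF assms] using W_pos[of x] by simp
  then show ?thesis by (rule sff_sq_zero)
qed

lemma linear_u:
  assumes "self_shrinker u" "flat_normal_bundle u"
  shows "linear u"
proof -
  have const: "u1 k x = u1 k 0" for k x
  proof -
    have "((\<lambda>x. u1 k x \<bullet> a) has_derivative (\<lambda>h. \<Sum>i\<in>UNIV. h $ i * (u2 i k x \<bullet> a))) (at x)" for a x
      by (intro has_derivative_continuous_partials continuous_intros u_continuous
          has_pd_bounded_linear[OF bounded_linear_inner_left] has_pd_u1)
    then have "((\<lambda>x. u1 k x \<bullet> a) has_derivative (\<lambda>h. 0)) (at x)" for a x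
      by (simp add: hessian_zero[OF assms])
    then have "u1 k x \<bullet> a = u1 k 0 \<bullet> a" for a
      using has_derivative_zero_unique[of UNIV "\<lambda>x. u1 k x \<bullet> a" 0 x] by simp
    then show ?thesis by (rule vector_eq_rdot[THEN iffD1, OF allI])
  qed
  \<comment> \<open>With vanishing second derivatives the shrinker equation says that
    \<open>u\<close> equals its radial derivative, which excludes an additive constant.\<close>
  have "u x = (\<Sum>k\<in>UNIV. x $ k *\<^sub>R u1 k 0)" for x
    using self_shrinker_equation[OF assms(1), of x] by (simp add: hessian_zero[OF assms] const[of _ x])
  then have "u = (\<lambda>x. \<Sum>k\<in>UNIV. x $ k *\<^sub>R u1 k 0)" by auto
  moreover have "linear (\<lambda>x. \<Sum>k\<in>UNIV. x $ k *\<^sub>R u1 k 0)"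
    by (intro bounded_linear.linear bounded_linear_sum bounded_linear_scaleR_const bounded_linear_vec_nth)
  ultimately show ?thesis by metis
qed

end

theorem theorem1p1:
  fixes u :: "real^'n::finite \<Rightarrow> real^'m::finite"
  assumes "smooth_map u"
    and "self_shrinker u"
    and "flat_normal_bundle u"
  shows "subspace (range (graph_map u))"
proof -
  interpret smooth_graph u using assms(1) by (rule smooth_graph.intro)
  have "linear u" using assms(2,3) by (rule linear_u)
  then have "linear (graph_map u)"
    unfolding graph_map_def by (intro linearI) (auto simp: linear_add linear_scale)
  then show ?thesis
    by (intro linear_subspace_image subspace_UNIV)
qed

end
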